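(* Every non-trivial normal subgroup of Thompson's group $F$ has cost $1$.
   Context: $F$ denotes Thompson's group: the group (under composition) of all piecewise linear homeomorphisms $f:[0,1]\to[0,1]$ that are differentiable except at finitely many dyadic rationals and such that on intervals of differentiability the derivatives are (integer) powers of $2$. Cost (Gaboriau). Let $(X,\lambda)$ be a standard Borel probability space. A measure-preserving countable equivalence relation (SP1 relation) on $(X,\lambda)$ is an equivalence relation $R$ that is a Borel subset of $X\times X$, such that almost every class $R[x]$ is at most countable, and such that every Borel automorphism $T$ of $X$ (non-singular, as usual) whose graph is contained in $R$ preserves $\lambda$. A graphing on $(X,\lambda)$ is a countable family $\Phi=(\varphi_i:A_i\to B_i)_{i\in I}$ of measure-preserving Borel partial isomorphisms between Borel subsets of $X$. The equivalence relation $R_\Phi$ generated by $\Phi$ is the smallest equivalence relation on $X$ containing all pairs $(x,\varphi_i(x))$ with $i\in I$, $x\in A_i$; $\Phi$ is a graphing of $R$ if $R_\Phi=R$ (up to null sets). Put $C(\Phi)=\sum_{i\in I}\lambda(A_i)$ and define the cost of $R$ by $$C(R)=\inf\{C(\Phi)\mid \Phi \text{ is a graphing of } R\}.$$ The cost of a countable discrete group $G$ is $$C(G)=\inf\{C(R)\mid R \text{ is the orbit equivalence relation of an (essentially) free, measure-preserving action of } G \text{ on } (X,\lambda)\}.$$ This does not depend on the choice of the standard Borel probability space $(X,\lambda)$. *)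

theory Defs
  imports "HOL-Probability.Probability_Measure" "HOL-Algebra.Group_Action"
begin

section \<open>Thompson's group\<close>

definition dyadic_rationals :: "real set" where
  "dyadic_rationals = {of_int k / 2 ^ n | (k :: int) (n :: nat). True}"

definition piecewise_linear_on_unit :: "(real \<Rightarrow> real) \<Rightarrow> bool" where
  "piecewise_linear_on_unit f \<longleftrightarrow>
     (\<exists>P. finite P \<and>
        (\<forall>a b. 0 \<le> a \<longrightarrow> a < b \<longrightarrow> b \<le> 1 \<longrightarrow> {a<..<b} \<inter> P = {} \<longrightarrow>
           (\<exists>c d. \<forall>x\<in>{a..b}. f x = c * x + d)))"

text \<open>
  Elements are functions on the reals that are undefined outside the unit interval
  (membership in the carrier of \<^term>\<open>BijGroup {0..1::real}\<close>); the product is composition.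
  The exceptional points 0 and 1 are dyadic, so using one-sided derivatives there is harmless.
\<close>

definition thompson_F :: "(real \<Rightarrow> real) monoid" where
  "thompson_F = (BijGroup {0..1}) \<lparr>carrier :=
     {f \<in> Bij {0..1}.
        (\<exists>g. homeomorphism {0..1} {0..1} f g) \<and>
        piecewise_linear_on_unit f \<and>
        (\<exists>D. finite D \<and> D \<subseteq> dyadic_rationals \<and>
           (\<forall>x\<in>{0..1} - D. \<exists>n::int.
              (f has_real_derivative 2 powi n) (at x within {0..1})))}\<rparr>"

section \<open>Standard Borel probability spaces and their isomorphisms\<close>

definition standard_borel :: "'a measure \<Rightarrow> bool" where
  "standard_borel M \<longleftrightarrow>
     (\<exists>X. completely_metrizable_space X \<and> second_countable X \<and>
        topspace X = space M \<and> sets M = sigma_sets (topspace X) {U. openin X U})"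

definition borel_isomorphism :: "'a measure \<Rightarrow> 'b measure \<Rightarrow> ('a \<Rightarrow> 'b) \<Rightarrow> bool" where
  "borel_isomorphism M N f \<longleftrightarrow>
     bij_betw f (space M) (space N) \<and> f \<in> M \<rightarrow>\<^sub>M N \<and> inv_into (space M) f \<in> N \<rightarrow>\<^sub>M M"

definition measure_preserving :: "'a measure \<Rightarrow> 'b measure \<Rightarrow> ('a \<Rightarrow> 'b) \<Rightarrow> bool" where
  "measure_preserving M N f \<longleftrightarrow> f \<in> M \<rightarrow>\<^sub>M N \<and> distr M N f = N"

definition nonsingular :: "'a measure \<Rightarrow> 'b measure \<Rightarrow> ('a \<Rightarrow> 'b) \<Rightarrow> bool" where
  "nonsingular M N f \<longleftrightarrow> f \<in> M \<rightarrow>\<^sub>M N \<and>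
     (\<forall>A\<in>sets N. emeasure M (f -` A \<inter> space M) = 0 \<longleftrightarrow> emeasure N A = 0)"

section \<open>Cost\<close>

definition sp1_relation :: "'a measure \<Rightarrow> ('a \<times> 'a) set \<Rightarrow> bool" where
  "sp1_relation M R \<longleftrightarrow>
     equiv (space M) R \<and>
     R \<in> sets (M \<Otimes>\<^sub>M M) \<and>
     (AE x in M. countable (R `` {x})) \<and>
     (\<forall>T. borel_isomorphism M M T \<and> nonsingular M M T \<and> (\<forall>x\<in>space M. (x, T x) \<in> R) \<longrightarrow>
        measure_preserving M M T)"

definition partial_isomorphism ::
    "'a measure \<Rightarrow> 'a set \<Rightarrow> 'a set \<Rightarrow> ('a \<Rightarrow> 'a) \<Rightarrow> bool" where
  "partial_isomorphism M A B f \<longleftrightarrow>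
     A \<in> sets M \<and> B \<in> sets M \<and>
     borel_isomorphism (restrict_space M A) (restrict_space M B) f \<and>
     measure_preserving (restrict_space M A) (restrict_space M B) f"

text \<open>
  A graphing is a family indexed by a countable set, which without loss of generality is a
  (finite or infinite) set \<open>I\<close> of natural numbers. The values of \<open>A\<close>, \<open>B\<close>, \<open>\<phi>\<close> outside \<open>I\<close>
  and of \<open>\<phi> i\<close> outside \<open>A i\<close> are irrelevant.
\<close>

definition graphing ::
    "'a measure \<Rightarrow> nat set \<Rightarrow> (nat \<Rightarrow> 'a set) \<Rightarrow> (nat \<Rightarrow> 'a set) \<Rightarrow> (nat \<Rightarrow> 'a \<Rightarrow> 'a) \<Rightarrow> bool" where
  "graphing M I A B \<phi> \<longleftrightarrow> (\<forall>i\<in>I. partial_isomorphism M (A i) (B i) (\<phi> i))"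

definition generated_relation ::
    "'a measure \<Rightarrow> nat set \<Rightarrow> (nat \<Rightarrow> 'a set) \<Rightarrow> (nat \<Rightarrow> 'a \<Rightarrow> 'a) \<Rightarrow> ('a \<times> 'a) set" where
  "generated_relation M I A \<phi> =
     \<Inter>{E. equiv (space M) E \<and> (\<forall>i\<in>I. \<forall>x\<in>A i. (x, \<phi> i x) \<in> E)}"

definition graphing_of ::
    "'a measure \<Rightarrow> ('a \<times> 'a) set \<Rightarrow> nat set \<Rightarrow> (nat \<Rightarrow> 'a set) \<Rightarrow> (nat \<Rightarrow> 'a set) \<Rightarrow>
     (nat \<Rightarrow> 'a \<Rightarrow> 'a) \<Rightarrow> bool" where
  "graphing_of M R I A B \<phi> \<longleftrightarrow>
     graphing M I A B \<phi> \<and> (AE x in M. generated_relation M I A \<phi> `` {x} = R `` {x})"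

definition graphing_cost :: "'a measure \<Rightarrow> nat set \<Rightarrow> (nat \<Rightarrow> 'a set) \<Rightarrow> ennreal" where
  "graphing_cost M I A = (\<Sum>\<^sub>\<infinity>i\<in>I. emeasure M (A i))"

definition relation_cost :: "'a measure \<Rightarrow> ('a \<times> 'a) set \<Rightarrow> ennreal" where
  "relation_cost M R = Inf {graphing_cost M I A | I A B \<phi>. graphing_of M R I A B \<phi>}"

definition mp_action :: "'a measure \<Rightarrow> ('g, 'c) monoid_scheme \<Rightarrow> ('g \<Rightarrow> 'a \<Rightarrow> 'a) \<Rightarrow> bool" where
  "mp_action M G \<alpha> \<longleftrightarrow>
     group_action G (space M) \<alpha> \<and> (\<forall>g\<in>carrier G. measure_preserving M M (\<alpha> g))"

definition essentially_free ::
    "'a measure \<Rightarrow> ('g, 'c) monoid_scheme \<Rightarrow> ('g \<Rightarrow> 'a \<Rightarrow> 'a) \<Rightarrow> bool" where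
  "essentially_free M G \<alpha> \<longleftrightarrow> (AE x in M. stabilizer G \<alpha> x = {\<one>\<^bsub>G\<^esub>})"

definition orbit_relation ::
    "'a measure \<Rightarrow> ('g, 'c) monoid_scheme \<Rightarrow> ('g \<Rightarrow> 'a \<Rightarrow> 'a) \<Rightarrow> ('a \<times> 'a) set" where
  "orbit_relation M G \<alpha> = {(x, y). x \<in> space M \<and> y \<in> orbit G \<alpha> x}"

text \<open>
  The underlying probability space is a parameter: the infimum ranges over the free actions on
  that space. It is the infimum of the empty set, that is \<open>\<infinity>\<close>, if there is no such action,
  as for an infinite group and a space with atoms.
\<close>

definition group_cost :: "'a measure \<Rightarrow> ('g, 'c) monoid_scheme \<Rightarrow> ennreal" where
  "group_cost M G =
     Inf {relation_cost M (orbit_relation M G \<alpha>) | \<alpha>. mp_action M G \<alpha> \<and> essentially_free M G \<alpha>}"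

text \<open>
  The definition of \<^const>\<open>group_cost\<close> does not mention \<^const>\<open>sp1_relation\<close> because orbit
  relations of measure-preserving actions of countable groups always have this property.
\<close>

lemma diagonal_measurable:
  assumes "standard_borel M"
  shows "{z \<in> space (M \<Otimes>\<^sub>M M). fst z = snd z} \<in> sets (M \<Otimes>\<^sub>M M)"
proof -
  obtain X where X: "completely_metrizable_space X" "second_countable X" "topspace X = space M"
      "sets M = sigma_sets (topspace X) {U. openin X U}"
    using assms unfolding standard_borel_def by blast
  obtain \<B> where \<B>: "countable \<B>" "\<And>V. V \<in> \<B> \<Longrightarrow> openin X V"
      "\<And>U x. openin X U \<Longrightarrow> x \<in> U \<Longrightarrow> \<exists>V\<in>\<B>. x \<in> V \<and> V \<subseteq> U"
    using X(2) unfolding second_countable_def by metis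
  have haus: "Hausdorff_space X"
    using X(1) by (simp add: completely_metrizable_imp_metrizable_space
        metrizable_imp_Hausdorff_space)
  define P where "P = {p \<in> \<B> \<times> \<B>. fst p \<inter> snd p = {}}"
  have "countable P"
    unfolding P_def by (rule countable_subset[of _ "\<B> \<times> \<B>"]) (use \<B>(1) in auto)
  have op: "V \<in> sets M" if "V \<in> \<B>" for V
    using X(4) \<B>(2)[OF that] by auto
  have "(\<Union>p\<in>P. fst p \<times> snd p) \<in> sets (M \<Otimes>\<^sub>M M)"
    by (rule sets.countable_UN'[OF \<open>countable P\<close>]) (auto simp: P_def intro!: pair_measureI op)
  moreover have "{z \<in> space (M \<Otimes>\<^sub>M M). fst z = snd z} =
      space (M \<Otimes>\<^sub>M M) - (\<Union>p\<in>P. fst p \<times> snd p)"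
  proof (intro Set.set_eqI iffI)
    fix z assume "z \<in> {z \<in> space (M \<Otimes>\<^sub>M M). fst z = snd z}"
    then show "z \<in> space (M \<Otimes>\<^sub>M M) - (\<Union>p\<in>P. fst p \<times> snd p)"
      by (auto simp: P_def)
  next
    fix z assume z: "z \<in> space (M \<Otimes>\<^sub>M M) - (\<Union>p\<in>P. fst p \<times> snd p)"
    have "fst z = snd z"
    proof (rule ccontr)
      assume ne: "fst z \<noteq> snd z"
      have "fst z \<in> topspace X" "snd z \<in> topspace X"
        using z X(3) by (auto simp: space_pair_measure)
      then obtain U V where UV: "openin X U" "openin X V" "fst z \<in> U" "snd z \<in> V" "disjnt U V"
        using haus ne unfolding Hausdorff_space_def by metis
      obtain U' V' where U': "U' \<in> \<B>" "fst z \<in> U'" "U' \<subseteq> U" and V': "V' \<in> \<B>" "snd z \<in> V'" "V' \<subseteq> V"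
        using \<B>(3) UV by metis
      then have "(U', V') \<in> P" using UV(5) by (auto simp: P_def disjnt_def)
      then show False using z U' V' by (cases z) force
    qed
    then show "z \<in> {z \<in> space (M \<Otimes>\<^sub>M M). fst z = snd z}" using z by auto
  qed
  ultimately show ?thesis by auto
qed

lemma equal_measurable:
  assumes "standard_borel M" "f \<in> N \<rightarrow>\<^sub>M M" "g \<in> N \<rightarrow>\<^sub>M M"
  shows "{x \<in> space N. f x = g x} \<in> sets N"
proof -
  have "(\<lambda>x. (f x, g x)) \<in> N \<rightarrow>\<^sub>M M \<Otimes>\<^sub>M M" using assms by simp
  from measurable_sets[OF this diagonal_measurable[OF assms(1)]]
  show ?thesis
    by (rule back_subst[of "\<lambda>A. A \<in> sets N"])
       (use measurable_space[OF assms(2)] measurable_space[OF assms(3)] in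
         \<open>auto simp: space_pair_measure\<close>)
qed

lemma emeasure_injective_image:
  assumes mp: "measure_preserving M M h" and inj: "inj_on h (space M)"
    and C: "C \<in> sets M" "h ` C \<in> sets M"
  shows "emeasure M (h ` C) = emeasure M C"
proof -
  have h: "h \<in> M \<rightarrow>\<^sub>M M" "distr M M h = M" using mp by (auto simp: measure_preserving_def)
  have "emeasure M (h ` C) = emeasure (distr M M h) (h ` C)" using h by simp
  also have "\<dots> = emeasure M (h -` (h ` C) \<inter> space M)"
    by (rule emeasure_distr) (use h C in auto)
  also have "h -` (h ` C) \<inter> space M = C"
    using inj sets.sets_into_space[OF C(1)] by (auto dest: inj_onD)
  finally show ?thesis .
qed

lemma orbit_relation_sp1:
  assumes M: "standard_borel M" and ct: "countable (carrier G)" and act: "mp_action M G \<alpha>"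
  shows "sp1_relation M (orbit_relation M G \<alpha>)"
proof -
  interpret group_action G "space M" \<alpha> using act by (simp add: mp_action_def)
  have mp: "measure_preserving M M (\<alpha> g)" if "g \<in> carrier G" for g
    using act that by (simp add: mp_action_def)
  have me: "\<alpha> g \<in> M \<rightarrow>\<^sub>M M" if "g \<in> carrier G" for g
    using mp[OF that] by (simp add: measure_preserving_def)
  interpret gh: group_hom G "BijGroup (space M)" \<alpha> by (rule group_hom)
  have R_eq: "orbit_relation M G \<alpha> = (\<Union>g\<in>carrier G. {z \<in> space (M \<Otimes>\<^sub>M M). \<alpha> g (fst z) = snd z})"
    using measurable_space[OF me]
    by (auto simp: orbit_relation_def orbit_def space_pair_measure)
  have orb: "y \<in> space M" if "x \<in> space M" "y \<in> orbit G \<alpha> x" for x y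
    using that element_image by (auto simp: orbit_def)
  have eq: "equiv (space M) (orbit_relation M G \<alpha>)"
  proof (rule equivI)
    show "orbit_relation M G \<alpha> \<subseteq> space M \<times> space M"
      unfolding R_eq by (auto simp: space_pair_measure)
    show "refl_on (space M) (orbit_relation M G \<alpha>)"
      using orbit_refl by (auto simp: refl_on_def orbit_relation_def)
    show "sym (orbit_relation M G \<alpha>)"
      using orbit_sym orb by (auto simp: sym_def orbit_relation_def)
    show "trans (orbit_relation M G \<alpha>)"
    proof (rule transI)
      fix x y z assume "(x, y) \<in> orbit_relation M G \<alpha>" "(y, z) \<in> orbit_relation M G \<alpha>"
      then have "x \<in> space M" "y \<in> orbit G \<alpha> x" "z \<in> orbit G \<alpha> y"
        by (simp_all add: orbit_relation_def)
      with orbit_trans[of x y z] orb[of x y] orb[of y z] show "(x, z) \<in> orbit_relation M G \<alpha>"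
        by (simp add: orbit_relation_def)
    qed
  qed
  have Rs: "orbit_relation M G \<alpha> \<in> sets (M \<Otimes>\<^sub>M M)"
    unfolding R_eq
    by (rule sets.countable_UN'[OF ct], safe, rule equal_measurable[OF M])
       (use me in \<open>auto intro: measurable_compose[OF measurable_fst]\<close>)
  have cl: "countable (orbit_relation M G \<alpha> `` {x})" for x
  proof (rule countable_subset)
    show "orbit_relation M G \<alpha> `` {x} \<subseteq> (\<lambda>g. \<alpha> g x) ` carrier G"
      by (auto simp: orbit_relation_def orbit_def)
  qed (use ct in auto)
  have T: "measure_preserving M M T"
    if iso: "borel_isomorphism M M T" and gr: "\<forall>x\<in>space M. (x, T x) \<in> orbit_relation M G \<alpha>" for T
  proof -
    have Tm: "T \<in> M \<rightarrow>\<^sub>M M" and Tb: "bij_betw T (space M) (space M)"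
      and Ti: "inv_into (space M) T \<in> M \<rightarrow>\<^sub>M M"
      using iso by (auto simp: borel_isomorphism_def)
    define A where "A g = {x \<in> space M. T x = \<alpha> g x}" for g
    have A: "A g \<in> sets M" if "g \<in> carrier G" for g
      unfolding A_def by (rule equal_measurable[OF M Tm me[OF that]])
    have Tim: "T ` C \<in> sets M" if "C \<in> sets M" for C
    proof -
      have "inv_into (space M) T -` C \<inter> space M = T ` C"
      proof (intro Set.set_eqI iffI)
        fix y assume y: "y \<in> inv_into (space M) T -` C \<inter> space M"
        then have "T (inv_into (space M) T y) = y"
          using Tb by (intro f_inv_into_f) (auto simp: bij_betw_def)
        with y show "y \<in> T ` C" by (metis IntD1 imageI vimageD)
      next
        fix y assume "y \<in> T ` C"
        then obtain x where x: "x \<in> C" "y = T x" by blast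
        then have "x \<in> space M" using sets.sets_into_space[OF that] by blast
        then show "y \<in> inv_into (space M) T -` C \<inter> space M"
          using x Tb by (auto simp: bij_betw_def inv_into_f_f)
      qed
      then show ?thesis using measurable_sets[OF Ti that] by simp
    qed
    define g where "g = from_nat_into (carrier G)"
    have ne: "carrier G \<noteq> {}" using gh.one_closed by blast
    have gc: "g n \<in> carrier G" for n unfolding g_def using ne by (rule from_nat_into)
    have gs: "\<exists>n. g n = h" if "h \<in> carrier G" for h
      unfolding g_def using from_nat_into_surj[OF ct that] .
    define D where "D = disjointed (\<lambda>n. A (g n))"
    have Ds: "D n \<in> sets M" for n
      using sets.range_disjointed_sets[of "\<lambda>n. A (g n)" M] A[OF gc] unfolding D_def by blast
    have DA: "D n \<subseteq> A (g n)" for n unfolding D_def by (rule disjointed_subset)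
    have Dd: "disjoint_family D" unfolding D_def by (rule disjoint_family_disjointed)
    have DU: "(\<Union>n. D n) = space M"
    proof -
      have "(\<Union>n. A (g n)) = space M"
      proof safe
        fix x assume "x \<in> space M"
        then obtain h where "h \<in> carrier G" "T x = \<alpha> h x"
          using gr by (auto simp: orbit_relation_def orbit_def)
        then show "x \<in> (\<Union>n. A (g n))"
          using gs \<open>x \<in> space M\<close> by (fastforce simp: A_def)
      qed (auto simp: A_def)
      then show ?thesis unfolding D_def by (simp add: UN_disjointed_eq)
    qed
    have im: "emeasure M (T ` C) = emeasure M C" if C: "C \<in> sets M" for C
    proof -
      have dis: "disjoint_family (\<lambda>n. C \<inter> D n)"
        using Dd by (auto simp: disjoint_family_on_def)
      have CU: "C = (\<Union>n. C \<inter> D n)" using DU sets.sets_into_space[OF C] by blast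
      have pc: "emeasure M (T ` (C \<inter> D n)) = emeasure M (C \<inter> D n)" for n
      proof -
        have "T ` (C \<inter> D n) = \<alpha> (g n) ` (C \<inter> D n)"
          using DA[of n] by (intro image_cong) (auto simp: A_def)
        moreover have "T ` (C \<inter> D n) \<in> sets M" using Tim C Ds by blast
        ultimately show ?thesis
          using emeasure_injective_image[OF mp[OF gc] inj_prop[OF gc]] C Ds by (metis sets.Int)
      qed
      have dis': "disjoint_family (\<lambda>n. T ` (C \<inter> D n))"
        unfolding disjoint_family_on_def
      proof (intro ballI impI)
        fix m n :: nat assume "m \<noteq> n"
        have "T ` (C \<inter> D m) \<inter> T ` (C \<inter> D n) = T ` ((C \<inter> D m) \<inter> (C \<inter> D n))"
          by (rule inj_on_image_Int[symmetric, where C = "space M"])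
             (use Tb sets.sets_into_space[OF C] in \<open>auto simp: bij_betw_def\<close>)
        then show "T ` (C \<inter> D m) \<inter> T ` (C \<inter> D n) = {}"
          using dis \<open>m \<noteq> n\<close> by (auto simp: disjoint_family_on_def)
      qed
      have "emeasure M (T ` C) = emeasure M (\<Union>n. T ` (C \<inter> D n))"
        by (subst CU) (simp only: image_UN)
      also have "\<dots> = (\<Sum>n. emeasure M (T ` (C \<inter> D n)))"
        by (rule suminf_emeasure[symmetric]) (use Tim C Ds dis' in auto)
      also have "\<dots> = (\<Sum>n. emeasure M (C \<inter> D n))" by (simp only: pc)
      also have "\<dots> = emeasure M (\<Union>n. C \<inter> D n)"
        by (rule suminf_emeasure) (use C Ds dis in auto)
      also have "\<dots> = emeasure M C" using CU by simp
      finally show ?thesis .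
    qed
    have "distr M M T = M"
    proof (rule measure_eqI)
      fix C assume "C \<in> sets (distr M M T)"
      then have C: "C \<in> sets M" by simp
      let ?C = "T -` C \<inter> space M"
      have "?C \<in> sets M" using measurable_sets[OF Tm C] .
      moreover have "T ` ?C = C"
      proof -
        have "T ` ?C = C \<inter> T ` space M" by auto
        then show ?thesis
          using bij_betw_imp_surj_on[OF Tb] sets.sets_into_space[OF C] by (simp add: Int_absorb2)
      qed
      ultimately show "emeasure (distr M M T) C = emeasure M C"
        using im[of ?C] by (simp add: emeasure_distr[OF Tm C])
    qed simp
    then show ?thesis using Tm by (simp add: measure_preserving_def)
  qed
  show ?thesis unfolding sp1_relation_def using eq Rs cl T by auto
qed

end

theory Submission
  imports Defs "HOL-Probability.Weak_Convergence" "HOL-Probability.Infinite_Product_Measure"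
begin

text \<open>
  The cost is at least 1 for every essentially free action, because the group is infinite. Let
  \<open>Y\<close> be a small measurable set that meets almost every orbit; such sets exist since a free action
  of a group with \<open>n\<close> given elements admits a set with \<open>n\<close> disjoint translates whose
  translates under the quotients of those elements cover almost everything (\<open>marker_set\<close>).
  In a graphing of the orbit relation almost every point is joined to \<open>Y\<close> by a path. Let every
  point outside \<open>Y\<close> choose an edge that begins a shortest path to \<open>Y\<close>. The distance to \<open>Y\<close> drops
  along a chosen edge, so no edge is chosen from both ends, and the edges have total measure at
  least \<open>1 - \<mu>(Y)\<close> (\<open>measure_le_graphing_cost_plus_section\<close>).

  The cost is at most 1 because of commutation relations in the group. Suppose that a subrelation
  \<open>E\<close> of the orbit relation already identifies \<open>x\<close> with \<open>c x\<close> and with \<open>d x\<close> for almost all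
  \<open>x\<close>, where \<open>c\<close> has infinite order and \<open>g c = d g\<close>. To make \<open>E\<close> identify \<open>x\<close> with \<open>g x\<close> it
  suffices to add \<open>g\<close> on a set \<open>Y\<close> that meets the orbits of \<open>c\<close>: if \<open>c\<^sup>k x\<close> lies in \<open>Y\<close>, then
  \<open>x \<sim> c\<^sup>k x \<sim> g c\<^sup>k x = d\<^sup>k g x \<sim> g x\<close>. Since \<open>Y\<close> may be arbitrarily small, \<open>g\<close> is obtained at
  arbitrarily small cost. Thus a single element \<open>a\<close> of infinite order, used on the whole space at
  cost 1, suffices when all other elements can be reached from it by such steps
  (\<open>relation_cost_le_one\<close>).

  In a non-trivial normal subgroup \<open>N\<close> of \<open>F\<close> two steps are enough. A commutator of an element of
  \<open>N\<close> with an element of \<open>F\<close> of small support yields a non-trivial \<open>a\<close> in \<open>N\<close> that is the identity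
  near 0 and near 1. Given \<open>h\<close> in \<open>N\<close>, a conjugate \<open>c\<close> of \<open>a\<close> is supported so close to 0 that
  the supports of both \<open>c\<close> and \<open>b = h c h\<^sup>-\<^sup>1\<close> miss that of \<open>a\<close>. So \<open>b\<close> and \<open>c\<close> commute with
  \<open>a\<close> and are reached first, and \<open>h\<close> is reached next because \<open>h c = b h\<close>
  (\<open>normal_subgroup_linked\<close>). Non-trivial elements have infinite order since \<open>F\<close> consists of
  increasing maps.

  The infimum in the definition of the cost of a group must finally not be that of the empty set.
  As \<open>F\<close> is countable, \<open>N\<close> acts by shifts on a countable product of copies of the uniform
  distribution, and this action is essentially free. It is carried over to the given space, which
  is isomorphic modulo null sets to the product space: both are isomorphic to the unit interval
  (\<open>exists_free_pmp_action\<close>).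
\<close>

section \<open>Markers for free actions\<close>

text \<open>
  The action is bundled with the countability of the group and the regularity of the space, the
  setting in which orbit relations are measurable and almost-everywhere statements pass to all
  translates at once.
\<close>

locale free_pmp_action = prob_space M
  for M :: "'a measure" and G :: "('g, 'c) monoid_scheme" (structure) and \<alpha> +
  assumes standard: "standard_borel M"
    and countable_group: "countable (carrier G)"
    and action: "mp_action M G \<alpha>"
    and free: "essentially_free M G \<alpha>"
begin

sublocale group_action G "space M" \<alpha>
  using action by (simp add: mp_action_def)

sublocale group G
  using group_hom by (rule group_hom.axioms(1))

lemma act_measurable: "g \<in> carrier G \<Longrightarrow> \<alpha> g \<in> M \<rightarrow>\<^sub>M M"
  using action by (simp add: mp_action_def measure_preserving_def)

lemma act_distr: "g \<in> carrier G \<Longrightarrow> distr M M (\<alpha> g) = M"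
  using action by (simp add: mp_action_def measure_preserving_def)

lemma act_one: "x \<in> space M \<Longrightarrow> \<alpha> \<one> x = x"
  using id_eq_one by (metis restrict_apply)

lemma prob_vimage_act:
  assumes "g \<in> carrier G" "B \<in> sets M"
  shows "prob (\<alpha> g -` B \<inter> space M) = prob B"
  using measure_distr[OF act_measurable[OF assms(1)] assms(2)] act_distr[OF assms(1)] by simp

text \<open>
  Turns an almost sure property into one that holds along whole orbits: its exceptional set may be
  replaced by the union of countably many null translates.
\<close>

lemma AE_translates:
  assumes "AE x in M. P x"
  shows "AE x in M. \<forall>g\<in>carrier G. P (\<alpha> g x)"
proof -
  have "AE x in M. P (\<alpha> g x)" if "g \<in> carrier G" for g
    by (rule AE_distrD[OF act_measurable[OF that]]) (unfold act_distr[OF that], rule assms)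
  then show ?thesis
    by (simp add: AE_ball_countable[OF countable_group])
qed

text \<open>
  A greedy construction. Let \<open>F\<close> be the set of non-trivial quotients \<open>s t\<^sup>-\<^sup>1\<close>. As the action is
  free, almost every point has a basic open neighbourhood \<open>U\<close> that avoids its \<open>F\<close>-translates, so
  countably many sets \<open>E\<close> disjoint from their own \<open>F\<close>-translates cover almost the whole space. Add
  to \<open>B\<close>, one \<open>E\<close> after the other, all points of \<open>E\<close> that have no \<open>F\<close>-translate in \<open>B\<close> so far. In
  the end \<open>B\<close> is disjoint from its \<open>F\<close>-translates, which makes the preimages of \<open>B\<close> under the
  elements of \<open>S\<close> disjoint and bounds its measure, and every point was either added or has an
  \<open>F\<close>-translate in \<open>B\<close>.
\<close>

lemma marker_set:
  assumes S: "finite S" "S \<noteq> {}" "S \<subseteq> carrier G"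
  obtains B where "B \<in> sets M" "real (card S) * prob B \<le> 1"
    "AE x in M. \<exists>s\<in>S. \<exists>t\<in>S. \<alpha> (s \<otimes> inv t) x \<in> B"
proof -
  define F where "F = {s \<otimes> inv t |s t. s \<in> S \<and> t \<in> S \<and> s \<noteq> t}"
  have Fc: "F \<subseteq> carrier G" using S(3) by (auto simp: F_def)
  have Ffin: "finite F"
    by (rule finite_subset[of _ "(\<lambda>(s, t). s \<otimes> inv t) ` (S \<times> S)"]) (use S in \<open>auto simp: F_def\<close>)
  have F1: "\<one> \<notin> F"
  proof
    assume "\<one> \<in> F"
    then obtain s t where "s \<in> S" "t \<in> S" "s \<noteq> t" "s \<otimes> inv t = \<one>" by (auto simp: F_def)
    then show False using S(3) by (metis inv_equality inv_inv inv_closed subsetD)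
  qed
  \<comment> \<open>Only the symmetry of F makes the greedy choice work: a point of B must not become a translate of
    a point that is added later.\<close>
  have Finv: "inv f \<in> F" if "f \<in> F" for f
  proof -
    obtain s t where st: "f = s \<otimes> inv t" "s \<in> S" "t \<in> S" "s \<noteq> t" using \<open>f \<in> F\<close> by (auto simp: F_def)
    then have "inv f = t \<otimes> inv s" using S(3) by (simp add: inv_mult_group subset_iff)
    then show ?thesis using st by (auto simp: F_def)
  qed
  obtain X where X: "completely_metrizable_space X" "second_countable X" "topspace X = space M"
      "sets M = sigma_sets (topspace X) {U. openin X U}"
    using standard unfolding standard_borel_def by blast
  obtain \<B> where \<B>: "countable \<B>" "\<And>V. V \<in> \<B> \<Longrightarrow> openin X V"
      "\<And>U x. openin X U \<Longrightarrow> x \<in> U \<Longrightarrow> \<exists>V\<in>\<B>. x \<in> V \<and> V \<subseteq> U"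
    using X(2) unfolding second_countable_def by metis
  have t1: "t1_space X"
    using X(1) by (simp add: completely_metrizable_imp_metrizable_space
        metrizable_imp_Hausdorff_space Hausdorff_imp_t1_space)
  define U where "U = from_nat_into (insert {} \<B>)"
  have U_op: "openin X (U k)" for k
  proof -
    have "U k \<in> insert {} \<B>" unfolding U_def by (rule from_nat_into) simp
    then show ?thesis using \<B>(2) by auto
  qed
  have U_sets: "U k \<in> sets M" for k using U_op[of k] X(4) by auto
  have U_sur: "\<exists>k. U k = V" if "V \<in> \<B>" for V
    unfolding U_def using from_nat_into_surj[of "insert {} \<B>" V] \<B>(1) that by simp
  define E where "E k = {y \<in> U k. \<forall>f\<in>F. \<alpha> f y \<notin> U k}" for k
  have E_eq: "E k = U k - (\<Union>f\<in>F. \<alpha> f -` U k \<inter> space M)" for k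
    using sets.sets_into_space[OF U_sets[of k]] by (auto simp: E_def)
  have E_sets: "E k \<in> sets M" for k
    unfolding E_eq using U_sets Ffin Fc act_measurable
    by (intro sets.Diff sets.finite_UN measurable_sets) auto
  define B where "B = rec_nat {} (\<lambda>k b. b \<union> (E k - (\<Union>f\<in>F. \<alpha> f -` b \<inter> space M)))"
  have B0: "B 0 = {}" and BS: "B (Suc k) = B k \<union> (E k - (\<Union>f\<in>F. \<alpha> f -` B k \<inter> space M))" for k
    by (simp_all add: B_def)
  have B_sets: "B k \<in> sets M" for k
  proof (induction k)
    case (Suc k)
    then show ?case
      unfolding BS using E_sets Ffin Fc act_measurable
      by (intro sets.Un sets.Diff sets.finite_UN measurable_sets) auto
  qed (simp add: B0)
  have B_sp: "x \<in> space M" if "x \<in> B k" for x k using sets.sets_into_space[OF B_sets] that by blast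
  have B_mono: "B j \<subseteq> B k" if "j \<le> k" for j k
    by (rule lift_Suc_mono_le[OF _ that]) (auto simp: BS)
  have sep: "\<alpha> f y \<notin> B k" if "y \<in> B k" "f \<in> F" for f y k
    using that
  proof (induction k arbitrary: f y)
    case 0
    then show ?case by (simp add: B0)
  next
    case (Suc k)
    have y: "y \<in> space M" using Suc.prems B_sp by blast
    have inv_back: "\<alpha> (inv f) (\<alpha> f y) = y" using orbit_sym_aux y Suc.prems(2) Fc by blast
    show ?case
    proof
      assume "\<alpha> f y \<in> B (Suc k)"
      then consider (old) "\<alpha> f y \<in> B k" | (new) "\<alpha> f y \<in> E k" "\<And>h. h \<in> F \<Longrightarrow> \<alpha> h (\<alpha> f y) \<notin> B k"
        using B_sp[of "\<alpha> f y" "Suc k"] by (auto simp: BS)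
      then show False
      proof cases
        case old
        then show False using Suc y unfolding BS by blast
      next
        case new
        then have "y \<notin> B k" using inv_back Finv Suc.prems(2) by metis
        then have "y \<in> E k" using Suc.prems by (auto simp: BS)
        then show False using new Suc.prems(2) by (auto simp: E_def)
      qed
    qed
  qed
  have sep': "\<alpha> f y \<notin> (\<Union>k. B k)" if y: "y \<in> (\<Union>k. B k)" and f: "f \<in> F" for f y
  proof
    assume "\<alpha> f y \<in> (\<Union>k. B k)"
    then obtain i j where "y \<in> B i" "\<alpha> f y \<in> B j" using y by blast
    then have "y \<in> B (max i j)" "\<alpha> f y \<in> B (max i j)" using B_mono by (meson max.cobounded1 max.cobounded2 subsetD)+
    then show False using sep f by blast
  qed
  show thesis
  proof
    show Bs: "(\<Union>k. B k) \<in> sets M" using B_sets by blast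
    define P where "P s = \<alpha> s -` (\<Union>k. B k) \<inter> space M" for s
    have Ps: "P s \<in> sets M" if "s \<in> S" for s
      unfolding P_def by (rule measurable_sets[OF act_measurable Bs]) (use that S in auto)
    have dis: "disjoint_family_on P S"
      unfolding disjoint_family_on_def
    proof (intro ballI impI)
      fix s t assume st: "s \<in> S" "t \<in> S" "s \<noteq> t"
      show "P s \<inter> P t = {}"
      proof (rule ccontr)
        assume "P s \<inter> P t \<noteq> {}"
        then obtain x where x: "x \<in> space M" "\<alpha> s x \<in> (\<Union>k. B k)" "\<alpha> t x \<in> (\<Union>k. B k)"
          by (auto simp: P_def)
        have c: "s \<in> carrier G" "t \<in> carrier G" using st S by auto
        have "\<alpha> (t \<otimes> inv s) (\<alpha> s x) = \<alpha> t x"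
          using composition_rule[of "\<alpha> s x" t "inv s"] orbit_sym_aux[OF c(1) x(1) refl] c
            element_image[OF c(1) x(1) refl] by simp
        moreover have "t \<otimes> inv s \<in> F" using st by (auto simp: F_def)
        ultimately show False using sep' x by metis
      qed
    qed
    have "real (card S) * prob (\<Union>k. B k) = (\<Sum>s\<in>S. prob (P s))"
      using prob_vimage_act[OF _ Bs] S by (simp add: P_def subset_iff)
    also have "\<dots> = prob (\<Union>s\<in>S. P s)"
      by (rule finite_measure_finite_Union[symmetric]) (use S Ps dis in auto)
    also have "\<dots> \<le> 1" by simp
    finally show "real (card S) * prob (\<Union>k. B k) \<le> 1" .
    show "AE x in M. \<exists>s\<in>S. \<exists>t\<in>S. \<alpha> (s \<otimes> inv t) x \<in> (\<Union>k. B k)"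
      using free[unfolded essentially_free_def] AE_space
    proof eventually_elim
      fix x assume st: "stabilizer G \<alpha> x = {\<one>}" and x: "x \<in> space M"
      have nf: "\<alpha> f x \<noteq> x" if f: "f \<in> F" for f
      proof
        assume "\<alpha> f x = x"
        moreover have "f \<in> carrier G" using f Fc by blast
        ultimately have "f \<in> stabilizer G \<alpha> x" by (simp add: stabilizer_def)
        then show False using st f F1 by simp
      qed
      have "openin X (topspace X - (\<lambda>f. \<alpha> f x) ` F)"
        using t1 Ffin Fc element_image[OF _ x] X(3)
        by (intro openin_diff openin_topspace t1_space_closedin_finite[THEN iffD1, rule_format]) auto
      moreover have "x \<in> topspace X - (\<lambda>f. \<alpha> f x) ` F" using nf x X(3) by (auto dest: sym)
      ultimately obtain k where k: "x \<in> U k" "U k \<subseteq> topspace X - (\<lambda>f. \<alpha> f x) ` F"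
        using \<B>(3) U_sur by metis
      then have "x \<in> E k" by (auto simp: E_def)
      then consider "x \<in> B (Suc k)" | f where "f \<in> F" "\<alpha> f x \<in> B k" by (auto simp: BS)
      then show "\<exists>s\<in>S. \<exists>t\<in>S. \<alpha> (s \<otimes> inv t) x \<in> (\<Union>k. B k)"
      proof cases
        case 1
        obtain s where s: "s \<in> S" using S(2) by blast
        \<comment> \<open>A point of B itself is covered by a trivial quotient.\<close>
        then have "\<alpha> (s \<otimes> inv s) x = x" using S(3) act_one[OF x] by (simp add: subset_iff)
        then show ?thesis using 1 s by force
      next
        case 2
        then show ?thesis by (auto simp: F_def)
      qed
    qed
  qed
qed

lemma small_marker_set:
  assumes "infinite S" "S \<subseteq> carrier G" "0 < \<delta>"
  obtains B where "B \<in> sets M" "emeasure M B \<le> ennreal \<delta>"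
    "AE x in M. \<exists>s\<in>S. \<exists>t\<in>S. \<alpha> (s \<otimes> inv t) x \<in> B"
proof -
  obtain n :: nat where n: "1 / \<delta> < real n" using reals_Archimedean2 by blast
  obtain T where T: "T \<subseteq> S" "finite T" "card T = n" using infinite_arbitrarily_large[OF assms(1)] by blast
  have "0 < 1 / \<delta>" using assms by simp
  then have n0: "0 < real n" using n by linarith
  then have ne: "T \<noteq> {}" using T by auto
  obtain B where B: "B \<in> sets M" "real (card T) * prob B \<le> 1"
    "AE x in M. \<exists>s\<in>T. \<exists>t\<in>T. \<alpha> (s \<otimes> inv t) x \<in> B"
    using marker_set[OF T(2) ne] T(1) assms(2) by blast
  have "prob B \<le> 1 / real n" using B(2) T(3) n0 by (simp add: field_simps)
  also have "\<dots> \<le> \<delta>" using n n0 assms(3) by (simp add: field_simps)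
  finally have "emeasure M B \<le> ennreal \<delta>" by (simp add: emeasure_eq_measure ennreal_leI)
  moreover have "AE x in M. \<exists>s\<in>S. \<exists>t\<in>S. \<alpha> (s \<otimes> inv t) x \<in> B"
    using B(3) by eventually_elim (use T(1) in blast)
  ultimately show thesis using that B(1) by blast
qed

end

section \<open>The cost of a relation with infinite classes\<close>

lemma graphing_cost_suminf:
  "graphing_cost M I A = (\<Sum>i. if i \<in> I then emeasure M (A i) else 0)"
proof -
  have "graphing_cost M I A = (\<Sum>\<^sub>\<infinity>i\<in>UNIV. if i \<in> I then emeasure M (A i) else 0)"
    unfolding graphing_cost_def by (rule infsum_cong_neutral) auto
  also have "\<dots> = (\<Sum>i. if i \<in> I then emeasure M (A i) else 0)"
    by (rule sums_unique[OF has_sum_imp_sums[OF has_sum_infsum[OF nonneg_summable_on_complete]]]) simp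
  finally show ?thesis .
qed

lemma partial_isomorphism_image:
  assumes f: "partial_isomorphism M A B f" and C: "C \<in> sets M" "C \<subseteq> A"
  shows "f ` C \<in> sets M" "emeasure M (f ` C) = emeasure M C"
proof -
  have A: "A \<in> sets M" "B \<in> sets M" using f by (auto simp: partial_isomorphism_def)
  have sp: "space (restrict_space M A) = A" "space (restrict_space M B) = B"
    using sets.sets_into_space A by (auto simp: space_restrict_space)
  have bij: "bij_betw f A B" and inv: "inv_into A f \<in> restrict_space M B \<rightarrow>\<^sub>M restrict_space M A"
    and fm: "f \<in> restrict_space M A \<rightarrow>\<^sub>M restrict_space M B"
    and mp: "distr (restrict_space M A) (restrict_space M B) f = restrict_space M B"
    using f sp by (auto simp: partial_isomorphism_def borel_isomorphism_def measure_preserving_def)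
  have "C \<in> sets (restrict_space M A)" using C A by (simp add: sets_restrict_space_iff)
  from measurable_sets[OF inv this] have "inv_into A f -` C \<inter> B \<in> sets (restrict_space M B)"
    using sp by simp
  moreover have "inv_into A f -` C \<inter> B = f ` C"
    using bij C(2) by (force simp: bij_betw_def inv_into_f_f)
  ultimately have fC: "f ` C \<in> sets (restrict_space M B)" by simp
  then show "f ` C \<in> sets M" using A by (simp add: sets_restrict_space_iff)
  have "emeasure M (f ` C) = emeasure (restrict_space M B) (f ` C)"
    using fC A sets.sets_into_space[OF fC] sp by (subst emeasure_restrict_space) auto
  also have "\<dots> = emeasure (distr (restrict_space M A) (restrict_space M B) f) (f ` C)"
    using mp by simp
  also have "\<dots> = emeasure (restrict_space M A) (f -` (f ` C) \<inter> A)"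
    using emeasure_distr[OF fm fC] sp by simp
  also have "f -` (f ` C) \<inter> A = C" using bij C(2) by (auto simp: bij_betw_def dest: inj_onD)
  also have "emeasure (restrict_space M A) C = emeasure M C"
    using A C by (subst emeasure_restrict_space) auto
  finally show "emeasure M (f ` C) = emeasure M C" .
qed

lemma partial_isomorphism_vimage:
  assumes f: "partial_isomorphism M A B f" and C: "C \<in> sets M"
  shows "{x \<in> A. f x \<in> C} \<in> sets M"
proof -
  have A: "A \<in> sets M" "B \<in> sets M" using f by (auto simp: partial_isomorphism_def)
  have sp: "space (restrict_space M A) = A" "space (restrict_space M B) = B"
    using sets.sets_into_space A by (auto simp: space_restrict_space)
  have bij: "bij_betw f A B"
    and fm: "f \<in> restrict_space M A \<rightarrow>\<^sub>M restrict_space M B"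
    using f sp by (auto simp: partial_isomorphism_def borel_isomorphism_def)
  have "B \<inter> C \<in> sets (restrict_space M B)" using C A by (simp add: sets_restrict_space_iff)
  from measurable_sets[OF fm this] have "f -` (B \<inter> C) \<inter> A \<in> sets M"
    using sp A by (simp add: sets_restrict_space_iff)
  moreover have "f -` (B \<inter> C) \<inter> A = {x \<in> A. f x \<in> C}" using bij by (auto simp: bij_betw_def)
  ultimately show ?thesis by simp
qed

text \<open>
  Let \<open>D n\<close> be the set of points at distance at most \<open>n\<close> from \<open>Y\<close> in the graph of the graphing.
  An edge from \<open>x\<close> to \<open>\<phi> i x\<close> gets closer to \<open>Y\<close> if \<open>x\<close> lies in \<open>P i\<close>, and farther away if \<open>x\<close> lies
  in \<open>Q i\<close>. These are disjoint subsets of \<open>A i\<close>, and a point outside \<open>Y\<close> that is connected to \<open>Y\<close>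
  lies in some \<open>P i\<close> or in the image of some \<open>Q i\<close>. Hence the space is covered, up to a null set,
  by \<open>Y\<close> and by sets whose total measure is at most the cost.
\<close>

lemma measure_le_graphing_cost_plus_section:
  assumes gr: "graphing M I A B \<phi>" and Y: "Y \<in> sets M"
    and meets: "AE x in M. \<exists>y\<in>Y. (x, y) \<in> generated_relation M I A \<phi>"
  shows "emeasure M (space M) \<le> graphing_cost M I A + emeasure M Y"
proof -
  have pi: "partial_isomorphism M (A i) (B i) (\<phi> i)" if "i \<in> I" for i
    using gr that by (simp add: graphing_def)
  have As: "A i \<in> sets M" if "i \<in> I" for i using pi[OF that] by (simp add: partial_isomorphism_def)
  define D where "D = rec_nat Y (\<lambda>n d. d \<union> (\<Union>i\<in>I. {x \<in> A i. \<phi> i x \<in> d} \<union> \<phi> i ` (A i \<inter> d)))"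
  have D0: "D 0 = Y"
    and DS: "D (Suc n) = D n \<union> (\<Union>i\<in>I. {x \<in> A i. \<phi> i x \<in> D n} \<union> \<phi> i ` (A i \<inter> D n))" for n
    by (simp_all add: D_def)
  have Ds: "D n \<in> sets M" for n
  proof (induction n)
    case 0
    then show ?case using Y by (simp add: D0)
  next
    case (Suc n)
    have "{x \<in> A i. \<phi> i x \<in> D n} \<union> \<phi> i ` (A i \<inter> D n) \<in> sets M" if "i \<in> I" for i
      using partial_isomorphism_vimage[OF pi[OF that] Suc]
        partial_isomorphism_image(1)[OF pi[OF that], of "A i \<inter> D n"] As[OF that] Suc by blast
    then show ?case unfolding DS using Suc by (intro sets.Un sets.countable_UN') auto
  qed
  have Dm: "D m \<subseteq> D n" if "m \<le> n" for m n
    by (rule lift_Suc_mono_le[OF _ that]) (auto simp: DS)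
  define P where "P i = (\<Union>n. {x \<in> A i. \<phi> i x \<in> D n} - D n)" for i
  define Q where "Q i = (\<Union>n. (A i \<inter> D n) - {x \<in> A i. \<phi> i x \<in> D n})" for i
  have Ps: "P i \<in> sets M" and Qs: "Q i \<in> sets M" and QA: "Q i \<subseteq> A i" and PA: "P i \<subseteq> A i" if "i \<in> I" for i
    unfolding P_def Q_def
    using partial_isomorphism_vimage[OF pi[OF that] Ds] Ds As[OF that] by (auto intro!: sets.Diff sets.Int)
  have PQ: "P i \<inter> Q i = {}" for i
  proof (rule ccontr)
    assume "P i \<inter> Q i \<noteq> {}"
    then obtain x m n where "\<phi> i x \<in> D m" "x \<notin> D m" "x \<in> D n" "\<phi> i x \<notin> D n"
      unfolding P_def Q_def by blast
    then show False using Dm by (meson linear subsetD)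
  qed
  have "AE x in M. x \<in> Y \<union> (\<Union>i\<in>I. P i \<union> \<phi> i ` Q i)"
    using meets AE_space
  proof eventually_elim
    fix x assume "\<exists>y\<in>Y. (x, y) \<in> generated_relation M I A \<phi>" and x: "x \<in> space M"
    then obtain y where y: "y \<in> Y" "(x, y) \<in> generated_relation M I A \<phi>" by blast
    \<comment> \<open>The union of the D n is saturated: having finite distance to Y is an invariant of the classes.\<close>
    define E where "E = {(u, v). u \<in> space M \<and> v \<in> space M \<and> (u \<in> (\<Union>n. D n) \<longleftrightarrow> v \<in> (\<Union>n. D n))}"
    have "equiv (space M) E"
      unfolding E_def by (intro equivI refl_onI symI transI) auto
    moreover have "(u, \<phi> i u) \<in> E" if "i \<in> I" "u \<in> A i" for i u
    proof -
      have "A i \<subseteq> space M" using As[OF that(1)] sets.sets_into_space by blast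
      moreover have "\<phi> i u \<in> space M"
        using partial_isomorphism_image(1)[OF pi As, OF that(1) that(1)] sets.sets_into_space that(2) by blast
      moreover have "\<phi> i u \<in> D (Suc n)" if "u \<in> D n" for n
        using that \<open>i \<in> I\<close> \<open>u \<in> A i\<close> by (auto simp: DS)
      moreover have "u \<in> D (Suc n)" if "\<phi> i u \<in> D n" for n
        using that \<open>i \<in> I\<close> \<open>u \<in> A i\<close> by (auto simp: DS)
      ultimately show ?thesis using that unfolding E_def by blast
    qed
    ultimately have "generated_relation M I A \<phi> \<subseteq> E"
      unfolding generated_relation_def by (intro Inter_lower CollectI conjI ballI)
    then have "(x, y) \<in> E" using y(2) by (rule subsetD)
    then have xD: "\<exists>n. x \<in> D n" using y(1) D0 unfolding E_def by blast
    define n where "n = (LEAST n. x \<in> D n)"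
    have n: "x \<in> D n" using LeastI_ex[OF xD] by (simp add: n_def)
    show "x \<in> Y \<union> (\<Union>i\<in>I. P i \<union> \<phi> i ` Q i)"
    proof (cases n)
      case 0
      then show ?thesis using n D0 by simp
    next
      case (Suc m)
      then have nm: "x \<notin> D m" using not_less_Least[of m "\<lambda>n. x \<in> D n"] by (simp add: n_def)
      then obtain i where i: "i \<in> I" "x \<in> {x \<in> A i. \<phi> i x \<in> D m} \<union> \<phi> i ` (A i \<inter> D m)"
        using n by (auto simp: Suc DS)
      then have "x \<in> P i \<union> \<phi> i ` Q i"
        using nm unfolding P_def Q_def by blast
      then show ?thesis using i(1) by blast
    qed
  qed
  then have "emeasure M (space M) \<le> emeasure M (Y \<union> (\<Union>i\<in>I. P i \<union> \<phi> i ` Q i))"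
    using Y Ps Qs QA partial_isomorphism_image(1)[OF pi]
    by (intro emeasure_mono_AE) (auto intro!: sets.Un sets.countable_UN')
  also have "\<dots> \<le> emeasure M Y + emeasure M (\<Union>i\<in>I. P i \<union> \<phi> i ` Q i)"
    using Y Ps Qs QA partial_isomorphism_image(1)[OF pi]
    by (intro emeasure_subadditive) (auto intro!: sets.Un sets.countable_UN')
  also have "emeasure M (\<Union>i\<in>I. P i \<union> \<phi> i ` Q i)
      = emeasure M (\<Union>i. if i \<in> I then P i \<union> \<phi> i ` Q i else {})"
    by (rule arg_cong[of _ _ "emeasure M"]) auto
  also have "\<dots> \<le> (\<Sum>i. emeasure M (if i \<in> I then P i \<union> \<phi> i ` Q i else {}))"
    using Ps Qs QA partial_isomorphism_image(1)[OF pi]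
    by (intro emeasure_subadditive_countably) auto
  also have "\<dots> \<le> (\<Sum>i. if i \<in> I then emeasure M (A i) else 0)"
  proof (intro suminf_le)
    fix i
    show "emeasure M (if i \<in> I then P i \<union> \<phi> i ` Q i else {}) \<le> (if i \<in> I then emeasure M (A i) else 0)"
    proof (cases "i \<in> I")
      case True
      have "emeasure M (P i \<union> \<phi> i ` Q i) \<le> emeasure M (P i) + emeasure M (\<phi> i ` Q i)"
        using True Ps Qs QA partial_isomorphism_image(1)[OF pi] by (intro emeasure_subadditive) auto
      also have "\<dots> = emeasure M (P i) + emeasure M (Q i)"
        using True Qs QA partial_isomorphism_image(2)[OF pi] by simp
      also have "\<dots> = emeasure M (P i \<union> Q i)"
        using True Ps Qs PQ by (intro plus_emeasure) auto
      also have "\<dots> \<le> emeasure M (A i)"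
        using True PA QA As by (intro emeasure_mono) auto
      finally show ?thesis using True by simp
    qed simp
  qed auto
  finally show ?thesis by (simp add: graphing_cost_suminf add.commute)
qed

text \<open>
  Small marker sets serve as the section \<open>Y\<close>, so the cost is at least \<open>1 - \<epsilon>\<close> for every \<open>\<epsilon>\<close>.
\<close>

lemma (in free_pmp_action) relation_cost_ge_one:
  assumes inf: "infinite (carrier G)"
  shows "1 \<le> relation_cost M (orbit_relation M G \<alpha>)"
  unfolding relation_cost_def
proof (rule Inf_greatest, safe)
  fix I A B \<phi> assume gr: "graphing_of M (orbit_relation M G \<alpha>) I A B \<phi>"
  show "1 \<le> graphing_cost M I A"
  proof (rule ennreal_le_epsilon)
    fix e :: real assume "0 < e"
    then obtain Y where Y: "Y \<in> sets M" "emeasure M Y \<le> ennreal e"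
        "AE x in M. \<exists>s\<in>carrier G. \<exists>t\<in>carrier G. \<alpha> (s \<otimes> inv t) x \<in> Y"
      using small_marker_set[OF inf order_refl] by blast
    have "AE x in M. \<exists>y\<in>Y. (x, y) \<in> generated_relation M I A \<phi>"
      using Y(3) gr[unfolded graphing_of_def, THEN conjunct2] AE_space
    proof eventually_elim
      fix x assume "\<exists>s\<in>carrier G. \<exists>t\<in>carrier G. \<alpha> (s \<otimes> inv t) x \<in> Y"
        and eq: "generated_relation M I A \<phi> `` {x} = orbit_relation M G \<alpha> `` {x}" and x: "x \<in> space M"
      then obtain g where g: "g \<in> carrier G" "\<alpha> g x \<in> Y" by blast
      then have "\<alpha> g x \<in> orbit_relation M G \<alpha> `` {x}"
        using x by (auto simp: orbit_relation_def orbit_def)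
      then show "\<exists>y\<in>Y. (x, y) \<in> generated_relation M I A \<phi>" using eq g(2) by blast
    qed
    moreover have "graphing M I A B \<phi>" using gr by (simp add: graphing_of_def)
    ultimately have "1 \<le> graphing_cost M I A + emeasure M Y"
      using measure_le_graphing_cost_plus_section[of M I A B \<phi> Y] Y(1) by (simp add: emeasure_space_1)
    also have "\<dots> \<le> graphing_cost M I A + ennreal e" using Y(2) by (rule add_left_mono)
    finally show "1 \<le> graphing_cost M I A + ennreal e" .
  qed
qed

section \<open>Relations generated by restricted translations\<close>

lemma (in free_pmp_action) partial_isomorphism_act:
  assumes g: "g \<in> carrier G" and A: "A \<in> sets M"
  shows "partial_isomorphism M A (\<alpha> g ` A) (\<alpha> g)"
proof -
  have ig: "inv g \<in> carrier G" using g by simp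
  have Asp: "A \<subseteq> space M" using A sets.sets_into_space by blast
  have inv_act: "\<alpha> (inv g) (\<alpha> g x) = x" "\<alpha> g (\<alpha> (inv g) x) = x" if "x \<in> space M" for x
    using orbit_sym_aux[OF g that refl] orbit_sym_aux[OF ig that refl] g by simp_all
  have im: "\<alpha> g ` C = \<alpha> (inv g) -` C \<inter> space M" if "C \<subseteq> space M" for C
  proof (intro Set.set_eqI iffI)
    fix y assume "y \<in> \<alpha> g ` C"
    then show "y \<in> \<alpha> (inv g) -` C \<inter> space M"
      using inv_act(1) that element_image[OF g] by auto
  next
    fix y assume "y \<in> \<alpha> (inv g) -` C \<inter> space M"
    then show "y \<in> \<alpha> g ` C" using inv_act(2)[of y] by (auto intro: image_eqI[of _ _ "\<alpha> (inv g) y"])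
  qed
  have B: "\<alpha> g ` C \<in> sets M" if "C \<in> sets M" for C
    using im[of C] measurable_sets[OF act_measurable[OF ig] that] sets.sets_into_space[OF that] by simp
  have inj: "inj_on (\<alpha> g) A" using inj_prop[OF g] Asp by (rule inj_on_subset)
  have Bsp: "\<alpha> g ` A \<subseteq> space M" using B[OF A] sets.sets_into_space by blast
  have sp: "space (restrict_space M A) = A" "space (restrict_space M (\<alpha> g ` A)) = \<alpha> g ` A"
    using Asp Bsp by (auto simp: space_restrict_space)
  have m1: "\<alpha> g \<in> restrict_space M A \<rightarrow>\<^sub>M restrict_space M (\<alpha> g ` A)"
    by (intro measurable_restrict_space3 act_measurable g) auto
  have "\<alpha> (inv g) \<in> restrict_space M (\<alpha> g ` A) \<rightarrow>\<^sub>M restrict_space M A"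
    using inv_act(1) Asp by (intro measurable_restrict_space3 act_measurable ig) auto
  moreover have "inv_into A (\<alpha> g) y = \<alpha> (inv g) y" if "y \<in> \<alpha> g ` A" for y
    using that inj inv_act(1) Asp by (auto simp: inv_into_f_f)
  ultimately have m2: "inv_into A (\<alpha> g) \<in> restrict_space M (\<alpha> g ` A) \<rightarrow>\<^sub>M restrict_space M A"
    by (subst measurable_cong[where g = "\<alpha> (inv g)"]) (auto simp: sp)
  have "distr (restrict_space M A) (restrict_space M (\<alpha> g ` A)) (\<alpha> g) = restrict_space M (\<alpha> g ` A)"
  proof (rule measure_eqI)
    fix C assume "C \<in> sets (distr (restrict_space M A) (restrict_space M (\<alpha> g ` A)) (\<alpha> g))"
    then have C: "C \<in> sets (restrict_space M (\<alpha> g ` A))" by simp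
    then have C': "C \<in> sets M" "C \<subseteq> \<alpha> g ` A" using B[OF A] by (auto simp: sets_restrict_space_iff)
    have "x \<in> A" if x: "x \<in> space M" "\<alpha> g x \<in> C" for x
    proof -
      obtain y where y: "y \<in> A" "\<alpha> g x = \<alpha> g y" using x(2) C'(2) by blast
      then have "x = y" using inj_onD[OF inj_prop[OF g]] x(1) Asp by blast
      then show ?thesis using y by simp
    qed
    then have eq: "\<alpha> g -` C \<inter> A = \<alpha> g -` C \<inter> space M" using Asp by blast
    have "emeasure (distr (restrict_space M A) (restrict_space M (\<alpha> g ` A)) (\<alpha> g)) C
        = emeasure (restrict_space M A) (\<alpha> g -` C \<inter> A)"
      using emeasure_distr[OF m1 C] sp by simp
    also have "\<dots> = emeasure M (\<alpha> g -` C \<inter> space M)"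
      using A by (subst emeasure_restrict_space) (simp_all add: eq[symmetric])
    also have "\<dots> = emeasure M C"
      using emeasure_distr[OF act_measurable[OF g] C'(1)] act_distr[OF g] by simp
    also have "\<dots> = emeasure (restrict_space M (\<alpha> g ` A)) C"
      using B[OF A] C' by (subst emeasure_restrict_space) auto
    finally show "emeasure (distr (restrict_space M A) (restrict_space M (\<alpha> g ` A)) (\<alpha> g)) C
        = emeasure (restrict_space M (\<alpha> g ` A)) C" .
  qed simp
  then show ?thesis
    using A B m1 m2 inj sp
    by (auto simp: partial_isomorphism_def borel_isomorphism_def measure_preserving_def bij_betw_def)
qed

lemma (in free_pmp_action) equiv_orbit_relation: "equiv (space M) (orbit_relation M G \<alpha>)"
  using orbit_relation_sp1[OF standard countable_group action] by (simp add: sp1_relation_def)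

text \<open>
  The graphing consists of \<open>a\<close> on the whole space and, for every \<open>g\<close> and every \<open>c\<close> of infinite
  order, of \<open>g\<close> on a marker set for the powers of \<open>c\<close>; the measures of all these marker sets add up
  to at most \<open>\<epsilon>\<close>. The elements \<open>g\<close> that move points only within classes of the generated relation
  form a subgroup \<open>W\<close> containing \<open>a\<close>. If \<open>c\<close> and \<open>d\<close> are in \<open>W\<close> and \<open>g c = d g\<close>, then \<open>g\<close> is in
  \<open>W\<close>: walk from \<open>x\<close> to its translate \<open>k x\<close> in the marker set, where \<open>k\<close> is a quotient of powers
  of \<open>c\<close>, apply \<open>g\<close> there, and return from \<open>g k x = l g x\<close> to \<open>g x\<close> with the corresponding
  quotient \<open>l\<close> of powers of \<open>d\<close>.
\<close>

lemma (in free_pmp_action) relation_cost_le_one: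
  assumes a: "a \<in> carrier G"
    and inf_a: "inj (\<lambda>n::nat. a [^] n)"
    and link: "\<And>h. h \<in> carrier G \<Longrightarrow> \<exists>b\<in>carrier G. inj (\<lambda>n::nat. b [^] n) \<and> a \<otimes> b = b \<otimes> a \<and>
       (\<exists>c\<in>carrier G. inj (\<lambda>n::nat. c [^] n) \<and> a \<otimes> c = c \<otimes> a \<and> h \<otimes> c = b \<otimes> h)"
  shows "relation_cost M (orbit_relation M G \<alpha>) \<le> 1"
proof (rule ennreal_le_epsilon)
  fix e :: real assume e: "0 < e"
  define T where "T = carrier G \<times> {c \<in> carrier G. inj (\<lambda>n::nat. c [^] n)}"
  have ctT: "countable T"
    unfolding T_def by (rule countable_subset[OF _ countable_SIGMA[OF countable_group, of "\<lambda>_. carrier G"]])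
      (use countable_group in auto)
  have Tne: "T \<noteq> {}" using a inf_a by (auto simp: T_def)
  define p where "p = from_nat_into T"
  have p: "p n \<in> T" for n unfolding p_def using Tne by (rule from_nat_into)
  have p_sur: "\<exists>n. p n = t" if "t \<in> T" for t
    unfolding p_def using from_nat_into_surj[OF ctT that] .
  have fst_p: "fst (p n) \<in> carrier G" and snd_p: "snd (p n) \<in> carrier G"
    and inj_p: "inj (\<lambda>k::nat. snd (p n) [^] k)" for n
    using p[of n] by (auto simp: T_def)
  have "\<exists>A. A \<in> sets M \<and> emeasure M A \<le> ennreal (e * (1/2) ^ Suc n) \<and>
      (AE x in M. \<exists>(i::nat) (j::nat). \<alpha> (snd (p n) [^] i \<otimes> inv (snd (p n) [^] j)) x \<in> A)" for n
  proof -
    have "infinite (range (\<lambda>k::nat. snd (p n) [^] k))"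
      using inj_p by (simp add: finite_image_iff)
    moreover have "range (\<lambda>k::nat. snd (p n) [^] k) \<subseteq> carrier G" using snd_p by auto
    moreover have "0 < e * (1/2) ^ Suc n" using e by simp
    ultimately obtain A where "A \<in> sets M" "emeasure M A \<le> ennreal (e * (1/2) ^ Suc n)"
      "AE x in M. \<exists>s\<in>range (\<lambda>k::nat. snd (p n) [^] k). \<exists>t\<in>range (\<lambda>k::nat. snd (p n) [^] k).
         \<alpha> (s \<otimes> inv t) x \<in> A"
      by (rule small_marker_set)
    then show ?thesis by (intro exI[of _ A]) (auto elim!: eventually_mono)
  qed
  then obtain Y where Y0: "\<And>n. Y n \<in> sets M \<and> emeasure M (Y n) \<le> ennreal (e * (1/2) ^ Suc n) \<and>
      (AE x in M. \<exists>(i::nat) (j::nat). \<alpha> (snd (p n) [^] i \<otimes> inv (snd (p n) [^] j)) x \<in> Y n)"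
    using choice[of "\<lambda>n A. A \<in> sets M \<and> emeasure M A \<le> ennreal (e * (1/2) ^ Suc n) \<and>
      (AE x in M. \<exists>(i::nat) (j::nat). \<alpha> (snd (p n) [^] i \<otimes> inv (snd (p n) [^] j)) x \<in> A)"] by auto
  have Y: "Y n \<in> sets M" "emeasure M (Y n) \<le> ennreal (e * (1/2) ^ Suc n)"
      "AE x in M. \<exists>(i::nat) (j::nat). \<alpha> (snd (p n) [^] i \<otimes> inv (snd (p n) [^] j)) x \<in> Y n" for n
    using Y0[of n] by simp_all
  define \<phi> where "\<phi> = case_nat (\<alpha> a) (\<lambda>n. \<alpha> (fst (p n)))"
  define A where "A = case_nat (space M) Y"
  define B where "B i = \<phi> i ` A i" for i
  let ?R = "generated_relation M UNIV A \<phi>"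
  have gr: "graphing M UNIV A B \<phi>"
    unfolding graphing_def
  proof
    fix i :: nat
    show "partial_isomorphism M (A i) (B i) (\<phi> i)"
      using partial_isomorphism_act[OF a sets.top] partial_isomorphism_act[OF fst_p Y(1)]
      by (cases i) (simp_all add: A_def B_def \<phi>_def)
  qed
  have R_le: "?R \<subseteq> orbit_relation M G \<alpha>"
  proof -
    have "(x, \<phi> i x) \<in> orbit_relation M G \<alpha>" if "x \<in> A i" for i x
      using that sets.sets_into_space[OF Y(1)] a fst_p
      by (cases i) (auto simp: A_def \<phi>_def orbit_relation_def orbit_def subset_iff)
    then show ?thesis
      using equiv_orbit_relation unfolding generated_relation_def by (intro Inter_lower) auto
  qed
  have "AE x in M. ?R `` {x} = orbit_relation M G \<alpha> `` {x}"
  proof -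
    have "AE x in M. \<forall>n. \<exists>(i::nat) (j::nat). \<alpha> (snd (p n) [^] i \<otimes> inv (snd (p n) [^] j)) x \<in> Y n"
      using Y(3) by (simp add: AE_all_countable)
    from AE_translates[OF this] show ?thesis
      using AE_space
    proof eventually_elim
      fix x assume good: "\<forall>g\<in>carrier G. \<forall>n. \<exists>(i::nat) (j::nat).
          \<alpha> (snd (p n) [^] i \<otimes> inv (snd (p n) [^] j)) (\<alpha> g x) \<in> Y n" and x: "x \<in> space M"
      have "orbit_relation M G \<alpha> `` {x} \<subseteq> ?R `` {x}"
      proof
        fix y assume "y \<in> orbit_relation M G \<alpha> `` {x}"
        then obtain h where h: "h \<in> carrier G" "y = \<alpha> h x" by (auto simp: orbit_relation_def orbit_def)
        \<comment> \<open>The generated relation is an intersection, so the argument takes place in any equivalence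
          relation that contains the graphing.\<close>
        have "(x, y) \<in> E" if E: "equiv (space M) E" and gen: "\<forall>i\<in>UNIV. \<forall>x\<in>A i. (x, \<phi> i x) \<in> E" for E
        proof -
          have symE: "(v, u) \<in> E" if "(u, v) \<in> E" for u v using E that by (auto simp: equiv_def dest: symD)
          have transE: "(u, w) \<in> E" if "(u, v) \<in> E" "(v, w) \<in> E" for u v w
            using E that by (auto simp: equiv_def dest: transD)
          have reflE: "(u, u) \<in> E" if "u \<in> space M" for u
            using E that by (auto simp: equiv_def dest: refl_onD)
          \<comment> \<open>All marker sets are met from every point of this orbit, which is why W can be defined by an
            exact condition on the orbit of x.\<close>
          define X where "X = (\<lambda>g. \<alpha> g x) ` carrier G"
          have Xsp: "u \<in> space M" if "u \<in> X" for u using that element_image[OF _ x] by (auto simp: X_def)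
          have Xg: "\<alpha> g u \<in> X" if "u \<in> X" "g \<in> carrier G" for u g
          proof -
            obtain k where k: "k \<in> carrier G" "u = \<alpha> k x" using \<open>u \<in> X\<close> by (auto simp: X_def)
            then have "\<alpha> g u = \<alpha> (g \<otimes> k) x" using composition_rule[OF x] \<open>g \<in> carrier G\<close> by simp
            then show ?thesis using k \<open>g \<in> carrier G\<close> by (auto simp: X_def)
          qed
          define W where "W = {g \<in> carrier G. \<forall>u\<in>X. (u, \<alpha> g u) \<in> E}"
          have W1: "\<one> \<in> W" using reflE Xsp act_one by (auto simp: W_def)
          have Wm: "g \<otimes> k \<in> W" if "g \<in> W" "k \<in> W" for g k
          proof -
            have "(u, \<alpha> (g \<otimes> k) u) \<in> E" if u: "u \<in> X" for u
              using composition_rule[OF Xsp[OF u]] Xg[OF u] u \<open>g \<in> W\<close> \<open>k \<in> W\<close> transE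
              by (auto simp: W_def)
            then show ?thesis using that by (auto simp: W_def)
          qed
          have Wi: "inv g \<in> W" if "g \<in> W" for g
          proof -
            have g: "g \<in> carrier G" using that by (simp add: W_def)
            have "(u, \<alpha> (inv g) u) \<in> E" if u: "u \<in> X" for u
            proof -
              have "\<alpha> (inv g) u \<in> X" using Xg u g by simp
              then have "(\<alpha> (inv g) u, \<alpha> g (\<alpha> (inv g) u)) \<in> E" using \<open>g \<in> W\<close> by (simp add: W_def)
              moreover have "\<alpha> g (\<alpha> (inv g) u) = u"
                using orbit_sym_aux[of "inv g" u] Xsp[OF u] g by simp
              ultimately show ?thesis using symE by simp
            qed
            then show ?thesis using g by (auto simp: W_def)
          qed
          have Wp: "g [^] (n::nat) \<in> W" if "g \<in> W" for g n
            by (induction n) (use that W1 Wm in auto)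
          have step: "g \<in> W" if g: "g \<in> carrier G" and c: "c \<in> W" "inj (\<lambda>n::nat. c [^] n)"
              and d: "d \<in> W" and gc: "g \<otimes> c = d \<otimes> g" for g c d
          proof -
            have cc: "c \<in> carrier G" "d \<in> carrier G" using c d by (simp_all add: W_def)
            then obtain n where n: "p n = (g, c)" using p_sur[of "(g, c)"] g c by (auto simp: T_def)
            have pw: "g \<otimes> c [^] (m::nat) = d [^] m \<otimes> g" for m
            proof (induction m)
              case (Suc m)
              have "g \<otimes> c [^] Suc m = (g \<otimes> c [^] m) \<otimes> c" using g cc by (simp add: m_assoc)
              also have "\<dots> = d [^] m \<otimes> (g \<otimes> c)" using Suc g cc by (simp add: m_assoc)
              also have "\<dots> = d [^] Suc m \<otimes> g" using gc g cc by (simp add: m_assoc)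
              finally show ?case .
            qed (use g in simp)
            have "(u, \<alpha> g u) \<in> E" if u: "u \<in> X" for u
            proof -
              obtain k where k: "k \<in> carrier G" "u = \<alpha> k x" using u by (auto simp: X_def)
              obtain i j :: nat where ij: "\<alpha> (c [^] i \<otimes> inv (c [^] j)) u \<in> Y n"
                using good[rule_format, OF k(1), of n] n k(2) by auto
              define k where "k = c [^] i \<otimes> inv (c [^] j)"
              have k: "k \<in> W" unfolding k_def using Wm Wi Wp c by blast
              then have kc: "k \<in> carrier G" by (simp add: W_def)
              define l where "l = d [^] i \<otimes> inv (d [^] j)"
              have l: "l \<in> W" unfolding l_def using Wm Wi Wp d by blast
              then have lc: "l \<in> carrier G" by (simp add: W_def)
              have "inv (d [^] j) \<otimes> g = inv (d [^] j) \<otimes> (g \<otimes> c [^] j) \<otimes> inv (c [^] j)"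
                using g cc by (simp add: m_assoc)
              also have "\<dots> = inv (d [^] j) \<otimes> (d [^] j \<otimes> g) \<otimes> inv (c [^] j)" by (simp only: pw)
              also have "\<dots> = g \<otimes> inv (c [^] j)" using g cc by (simp add: m_assoc[symmetric])
              finally have iv: "g \<otimes> inv (c [^] j) = inv (d [^] j) \<otimes> g" ..
              have "g \<otimes> k = (g \<otimes> c [^] i) \<otimes> inv (c [^] j)" using g cc by (simp add: k_def m_assoc)
              also have "\<dots> = d [^] i \<otimes> (g \<otimes> inv (c [^] j))" using g cc by (simp add: pw m_assoc)
              also have "\<dots> = l \<otimes> g" using g cc by (simp add: iv l_def m_assoc)
              finally have gk: "g \<otimes> k = l \<otimes> g" .
              have "\<alpha> k u \<in> A (Suc n)" using ij by (simp add: A_def k_def)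
              then have "(\<alpha> k u, \<phi> (Suc n) (\<alpha> k u)) \<in> E" using gen by blast
              then have "(\<alpha> k u, \<alpha> g (\<alpha> k u)) \<in> E" using n by (simp add: \<phi>_def)
              also have "\<alpha> g (\<alpha> k u) = \<alpha> l (\<alpha> g u)"
                using gk composition_rule[OF Xsp[OF u]] g kc lc by metis
              finally have 1: "(\<alpha> k u, \<alpha> l (\<alpha> g u)) \<in> E" .
              have 2: "(u, \<alpha> k u) \<in> E" using k u by (simp add: W_def)
              have 3: "(\<alpha> g u, \<alpha> l (\<alpha> g u)) \<in> E" using l Xg[OF u g] by (simp add: W_def)
              show ?thesis using transE[OF transE[OF 2 1] symE[OF 3]] .
            qed
            then show ?thesis using g by (simp add: W_def)
          qed
          have aW: "a \<in> W"
          proof -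
            have "(u, \<alpha> a u) \<in> E" if "u \<in> X" for u
              using gen[rule_format, of 0 u] Xsp[OF that] by (simp add: A_def \<phi>_def)
            then show ?thesis using a by (simp add: W_def)
          qed
          \<comment> \<open>Here b and c are reached from a, since they commute with a, and then h from c and b.\<close>
          obtain b c where b: "b \<in> carrier G" "inj (\<lambda>n::nat. b [^] n)" "a \<otimes> b = b \<otimes> a"
            and c: "c \<in> carrier G" "inj (\<lambda>n::nat. c [^] n)" "a \<otimes> c = c \<otimes> a" "h \<otimes> c = b \<otimes> h"
            using link[OF h(1)] by blast
          have "b \<in> W" using step[OF b(1) aW inf_a aW] b by simp
          moreover have "c \<in> W" using step[OF c(1) aW inf_a aW] c by simp
          ultimately have "h \<in> W" using step[OF h(1)] c by blast
          moreover have "x \<in> X" using act_one[OF x] by (force simp: X_def)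
          ultimately show ?thesis using h(2) by (simp add: W_def)
        qed
        then show "y \<in> ?R `` {x}" by (auto simp: generated_relation_def)
      qed
      then show "?R `` {x} = orbit_relation M G \<alpha> `` {x}" using R_le by blast
    qed
  qed
  then have "graphing_of M (orbit_relation M G \<alpha>) UNIV A B \<phi>" using gr by (simp add: graphing_of_def)
  then have "relation_cost M (orbit_relation M G \<alpha>) \<le> graphing_cost M UNIV A"
    unfolding relation_cost_def by (intro Inf_lower) blast
  also have "graphing_cost M UNIV A = (\<Sum>n. emeasure M (A n))" by (simp add: graphing_cost_suminf)
  also have "\<dots> = (\<Sum>n. emeasure M (A (Suc n))) + emeasure M (A 0)"
    by (subst suminf_offset[of _ 1]) (auto simp: add.commute)
  also have "\<dots> \<le> (\<Sum>n. ennreal (e * (1/2) ^ Suc n)) + 1"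
    using Y(2) by (intro add_mono suminf_le) (auto simp: A_def emeasure_space_1)
  also have "(\<Sum>n. ennreal (e * (1/2) ^ Suc n)) = ennreal e"
  proof -
    have "(\<lambda>n. e * (1/2) ^ Suc n) sums (e * 1)" using power_half_series by (rule sums_mult)
    then show ?thesis using e by (intro suminf_ennreal_eq) auto
  qed
  finally show "relation_cost M (orbit_relation M G \<alpha>) \<le> 1 + ennreal e" by (simp add: add.commute)
qed

section \<open>Standard Borel spaces inside the real line\<close>

text \<open>
  Ternary digits are restricted to 0 and 1, so that expansions are unique and a digit can be read
  off from a comparison: the tail of the series contributes at most one half.
\<close>

definition ternary_code :: "(nat \<Rightarrow> bool) \<Rightarrow> real" where
  "ternary_code a = (\<Sum>k. of_bool (a k) * (1/3) ^ k)"

primrec ternary_tail :: "real \<Rightarrow> nat \<Rightarrow> real" where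
  "ternary_tail t 0 = t"
| "ternary_tail t (Suc k) = 3 * (ternary_tail t k - (if 1 \<le> ternary_tail t k then 1 else 0))"

definition ternary_digit :: "real \<Rightarrow> nat \<Rightarrow> bool" where
  "ternary_digit t k \<longleftrightarrow> 1 \<le> ternary_tail t k"

lemma summable_ternary: "summable (\<lambda>k. of_bool (a k) * (1/3 :: real) ^ k)"
  by (rule summable_comparison_test'[OF summable_geometric[of "1/3 :: real"], of 0]) auto

lemma ternary_code_nonneg: "0 \<le> ternary_code a"
  unfolding ternary_code_def by (rule suminf_nonneg[OF summable_ternary]) simp

lemma ternary_code_le: "ternary_code a \<le> 3 / 2"
proof -
  have "ternary_code a \<le> (\<Sum>k. (1/3 :: real) ^ k)"
    unfolding ternary_code_def by (rule suminf_le[OF _ summable_ternary summable_geometric]) auto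
  also have "\<dots> = 3 / 2" by (subst suminf_geometric) auto
  finally show ?thesis .
qed

lemma ternary_code_split: "ternary_code a = of_bool (a 0) + ternary_code (\<lambda>k. a (Suc k)) / 3"
proof -
  have "ternary_code a = (\<Sum>k. of_bool (a (Suc k)) * (1/3 :: real) ^ Suc k) + of_bool (a 0)"
    unfolding ternary_code_def using suminf_split_head[OF summable_ternary[of a]] by simp
  also have "(\<Sum>k. of_bool (a (Suc k)) * (1/3 :: real) ^ Suc k) = ternary_code (\<lambda>k. a (Suc k)) / 3"
    unfolding ternary_code_def using suminf_divide[OF summable_ternary[of "\<lambda>k. a (Suc k)"], of 3]
    by simp
  finally show ?thesis by simp
qed

lemma one_le_ternary_code_iff: "1 \<le> ternary_code a \<longleftrightarrow> a 0"
  using ternary_code_split[of a] ternary_code_nonneg[of "\<lambda>k. a (Suc k)"]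
    ternary_code_le[of "\<lambda>k. a (Suc k)"] by (cases "a 0") auto

lemma ternary_tail_code: "ternary_tail (ternary_code a) k = ternary_code (\<lambda>j. a (k + j))"
proof (induction k)
  case (Suc k)
  then show ?case
    using ternary_code_split[of "\<lambda>j. a (k + j)"] one_le_ternary_code_iff[of "\<lambda>j. a (k + j)"] by simp
qed simp

lemma ternary_digit_code: "ternary_digit (ternary_code a) k = a k"
  by (simp add: ternary_digit_def ternary_tail_code one_le_ternary_code_iff)

lemma measurable_ternary_tail [measurable]: "(\<lambda>t. ternary_tail t k) \<in> borel_measurable borel"
  by (induction k) simp_all

lemma measurable_ternary_digit [measurable]: "Measurable.pred borel (\<lambda>t. ternary_digit t k)"
  unfolding ternary_digit_def by measurable

lemma measurable_ternary_code [measurable]: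
  assumes [measurable]: "\<And>k. Measurable.pred M (\<lambda>x. a x k)"
  shows "(\<lambda>x. ternary_code (a x)) \<in> borel_measurable M"
  unfolding ternary_code_def by measurable

text \<open>
  Code a point \<open>x\<close> by the set of those \<open>k\<close> with \<open>x \<in> U k\<close>, where \<open>U\<close> enumerates a base, and regard
  the code as a real number. The main point is that the range is a Borel set; the inverse is then
  measurable because the digits describe the preimages of open sets. A code belongs to a point iff
  the closures of the coded sets have the finite intersection property, every coded \<open>U k\<close> contains
  the closure of another coded set, arbitrarily small sets are coded, and the code is closed under
  supersets: completeness then provides a point in all these closures, and its code is the given
  one. These are countably many conditions on the digits.
\<close>

lemma standard_borel_embedding:
  assumes std: "standard_borel M" and ne: "space M \<noteq> {}"
  obtains f :: "'a \<Rightarrow> real" and g where "f \<in> M \<rightarrow>\<^sub>M borel" "g \<in> borel \<rightarrow>\<^sub>M M"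
    "\<And>x. x \<in> space M \<Longrightarrow> g (f x) = x"
proof -
  obtain X where X: "completely_metrizable_space X" "second_countable X" "topspace X = space M"
      "sets M = sigma_sets (topspace X) {U. openin X U}"
    using std unfolding standard_borel_def by blast
  obtain S d where Sd: "Metric_space S d" "Metric_space.mcomplete S d" "X = Metric_space.mtopology S d"
    using X(1) unfolding completely_metrizable_space_def by blast
  interpret Metric_space S d by (rule Sd(1))
  have S: "S = space M" using X(3) Sd(3) by simp
  obtain \<B> where \<B>: "countable \<B>" "\<And>V. V \<in> \<B> \<Longrightarrow> openin X V"
      "\<And>U x. openin X U \<Longrightarrow> x \<in> U \<Longrightarrow> \<exists>V\<in>\<B>. x \<in> V \<and> V \<subseteq> U"
    using X(2) unfolding second_countable_def by metis
  define U where "U = from_nat_into (insert {} \<B>)"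
  have U_op: "openin X (U k)" for k
  proof -
    have "U k \<in> insert {} \<B>" unfolding U_def by (rule from_nat_into) simp
    then show ?thesis using \<B>(2) by auto
  qed
  have U_sets: "U k \<in> sets M" for k using U_op[of k] X(4) by auto
  have U_base: "\<exists>k. x \<in> U k \<and> U k \<subseteq> V" if V: "openin X V" "x \<in> V" for x V
  proof -
    obtain W where W: "W \<in> \<B>" "x \<in> W" "W \<subseteq> V" using \<B>(3)[OF V] by blast
    then obtain k where "U k = W"
      unfolding U_def using from_nat_into_surj[of "insert {} \<B>" W] \<B>(1) by auto
    then show ?thesis using W by blast
  qed
  have ball_base: "\<exists>k. x \<in> U k \<and> X closure_of U k \<subseteq> mcball x e" if x: "x \<in> S" and e: "0 < e" for x e
  proof -
    obtain k where k: "x \<in> U k" "U k \<subseteq> mball x e" using U_base[of "mball x e" x] x e Sd(3) by auto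
    then have "U k \<subseteq> mcball x e" using mball_subset_mcball by blast
    then have "X closure_of U k \<subseteq> mcball x e" using Sd(3) by (simp add: closure_of_minimal)
    then show ?thesis using k by blast
  qed
  \<comment> \<open>Finite sets of indices are represented by lists, so that the quantifier has a countable range.\<close>
  define Good where "Good t \<longleftrightarrow> ternary_code (ternary_digit t) = t \<and>
      (\<forall>js. (\<forall>j\<in>set js. ternary_digit t j) \<longrightarrow> (\<Inter>j\<in>set js. X closure_of U j) \<noteq> {}) \<and>
      (\<forall>k. ternary_digit t k \<longrightarrow> (\<exists>m\<in>{m. X closure_of U m \<subseteq> U k}. ternary_digit t m)) \<and>
      (\<forall>n. \<exists>m\<in>{m. \<exists>c. X closure_of U m \<subseteq> mcball c (1 / Suc n)}. ternary_digit t m) \<and>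
      (\<forall>m. \<forall>k\<in>{k. U m \<subseteq> U k}. ternary_digit t m \<longrightarrow> ternary_digit t k)" for t
  have [measurable]: "Measurable.pred borel Good"
  proof -
    have 1: "Measurable.pred borel (\<lambda>t. \<forall>js. (\<forall>j\<in>set js. ternary_digit t j) \<longrightarrow> (\<Inter>j\<in>set js. X closure_of U j) \<noteq> {})"
      by (intro pred_intros_countable pred_intros_countable_bounded pred_intros_logic measurable_ternary_digit) auto
    have 2: "Measurable.pred borel (\<lambda>t. \<forall>k. ternary_digit t k \<longrightarrow> (\<exists>m\<in>{m. X closure_of U m \<subseteq> U k}. ternary_digit t m))"
      by (intro pred_intros_countable pred_intros_countable_bounded pred_intros_logic measurable_ternary_digit)
    have 3: "Measurable.pred borel (\<lambda>t. \<forall>n::nat. \<exists>m\<in>{m. \<exists>c. X closure_of U m \<subseteq> mcball c (1 / Suc n)}. ternary_digit t m)"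
      by (intro pred_intros_countable pred_intros_countable_bounded pred_intros_logic measurable_ternary_digit)
    have 4: "Measurable.pred borel (\<lambda>t. \<forall>m. \<forall>k\<in>{k. U m \<subseteq> U k}. ternary_digit t m \<longrightarrow> ternary_digit t k)"
      by (intro pred_intros_countable pred_intros_countable_bounded pred_intros_logic measurable_ternary_digit)
    have 5: "Measurable.pred borel (\<lambda>t. ternary_code (ternary_digit t) = t)" by measurable
    show ?thesis unfolding Good_def by (intro pred_intros_logic 1 2 3 4 5)
  qed
  define f where "f x = ternary_code (\<lambda>k. x \<in> U k)" for x
  have digit_f: "ternary_digit (f x) k \<longleftrightarrow> x \<in> U k" for x k
    by (simp add: f_def ternary_digit_code)
  have f_meas: "f \<in> M \<rightarrow>\<^sub>M borel"
    unfolding f_def using U_sets by (intro measurable_ternary_code pred_sets2[where N = M]) auto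
  have f_inj: "x = y" if xy: "x \<in> S" "y \<in> S" "f x = f y" for x y
  proof (rule ccontr)
    assume ne: "x \<noteq> y"
    then have "0 < d x y" using xy by simp
    then obtain k where k: "x \<in> U k" "U k \<subseteq> mball x (d x y)"
      using U_base[of "mball x (d x y)" x] xy Sd(3) by auto
    then have "y \<in> U k" using xy(3) digit_f by metis
    then show False using k xy by auto
  qed
  have Good_f: "Good (f x)" if x: "x \<in> S" for x
  proof -
    have cl: "U k \<subseteq> X closure_of U k" for k using U_op by (simp add: closure_of_subset openin_subset)
    have "\<exists>m. X closure_of U m \<subseteq> U k \<and> x \<in> U m" if xk: "x \<in> U k" for k
    proof -
      obtain e where e: "0 < e" "mball x e \<subseteq> U k"
        using U_op[of k] xk unfolding Sd(3) openin_mtopology by blast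
      obtain m where "x \<in> U m" "X closure_of U m \<subseteq> mcball x (e / 2)" using ball_base[OF x, of "e / 2"] e by auto
      moreover have "mcball x (e / 2) \<subseteq> mball x e" using e(1) by (intro mcball_subset_mball_concentric) auto
      ultimately show ?thesis using e(2) by blast
    qed
    moreover have "\<exists>m. (\<exists>c. X closure_of U m \<subseteq> mcball c (1 / Suc n)) \<and> x \<in> U m" for n
      using ball_base[OF x, of "1 / Suc n"] by auto
    moreover have "(\<Inter>j\<in>J. X closure_of U j) \<noteq> {}" if "\<forall>j\<in>J. x \<in> U j" for J
      using that cl by blast
    ultimately show ?thesis
      unfolding Good_def digit_f by (auto simp: f_def)
  qed
  have Good_imp: "\<exists>x\<in>S. f x = t" if G: "Good t" for t
  proof -
    have G': "ternary_code (ternary_digit t) = t"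
      "\<And>js. \<forall>j\<in>set js. ternary_digit t j \<Longrightarrow> (\<Inter>j\<in>set js. X closure_of U j) \<noteq> {}"
      "\<And>k. ternary_digit t k \<Longrightarrow> \<exists>m. X closure_of U m \<subseteq> U k \<and> ternary_digit t m"
      "\<And>n. \<exists>m c. X closure_of U m \<subseteq> mcball c (1 / Suc n) \<and> ternary_digit t m"
      "\<And>m k. U m \<subseteq> U k \<Longrightarrow> ternary_digit t m \<Longrightarrow> ternary_digit t k"
      using G unfolding Good_def by blast+
    define \<C> where "\<C> = (\<lambda>k. X closure_of U k) ` {k. ternary_digit t k}"
    have "\<Inter>\<C> \<noteq> {}"
    proof (rule Sd(2)[unfolded mcomplete_fip, rule_format], intro conjI allI impI ballI)
      fix C assume "C \<in> \<C>" then show "closedin mtopology C" by (auto simp: \<C>_def Sd(3))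
    next
      fix e :: real assume "0 < e"
      then obtain n where n: "1 / Suc n < e" using reals_Archimedean[of e] by (auto simp: inverse_eq_divide)
      obtain m c where m: "X closure_of U m \<subseteq> mcball c (1 / Suc n)" "ternary_digit t m" using G'(4) by blast
      have "mcball c (1 / Suc n) \<subseteq> mcball c e" using n by (intro mcball_subset_concentric) auto
      then show "\<exists>C a. C \<in> \<C> \<and> C \<subseteq> mcball a e" using m by (auto simp: \<C>_def)
    next
      fix \<F> assume "finite \<F> \<and> \<F> \<subseteq> \<C>"
      then obtain J where "J \<subseteq> {k. ternary_digit t k}" "finite J" "\<F> = (\<lambda>k. X closure_of U k) ` J"
        unfolding \<C>_def using finite_subset_image by metis
      moreover from this obtain js where "set js = J" using finite_list by blast
      ultimately show "\<Inter>\<F> \<noteq> {}" using G'(2)[of js] by auto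
    qed
    then obtain x where x: "\<And>k. ternary_digit t k \<Longrightarrow> x \<in> X closure_of U k" by (auto simp: \<C>_def)
    have xU: "x \<in> U k" if "ternary_digit t k" for k using G'(3)[OF that] x by blast
    have xS: "x \<in> S" using G'(4)[of 0] xU openin_subset[OF U_op] X(3) S by blast
    \<comment> \<open>Conversely, U k contains a small coded set around x, and the code is closed under supersets.\<close>
    have Ux: "ternary_digit t k" if xk: "x \<in> U k" for k
    proof -
      obtain e where e: "0 < e" "mball x e \<subseteq> U k"
        using U_op[of k] xk unfolding Sd(3) openin_mtopology by blast
      obtain n where n: "1 / Suc n < e / 2" using reals_Archimedean[of "e / 2"] e by (auto simp: inverse_eq_divide)
      obtain m c where m: "X closure_of U m \<subseteq> mcball c (1 / Suc n)" "ternary_digit t m" using G'(4) by blast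
      have "y \<in> mball x e" if y: "y \<in> U m" for y
      proof -
        have "y \<in> mcball c (1 / Suc n)" "x \<in> mcball c (1 / Suc n)"
          using m y xU[OF m(2)] closure_of_subset[OF openin_subset[OF U_op[of m]]] by auto
        then have "d c y \<le> 1 / Suc n" "d c x \<le> 1 / Suc n" "c \<in> S" "y \<in> S" by auto
        then have "d x y < e" using triangle[of x c y] xS n commute[of c x] by simp
        then show ?thesis using xS \<open>y \<in> S\<close> by simp
      qed
      then show ?thesis using G'(5)[of m k] m(2) e(2) by blast
    qed
    have "f x = ternary_code (ternary_digit t)"
      unfolding f_def using xU Ux by (intro arg_cong[of _ _ ternary_code] ext) blast
    then show ?thesis using G'(1) xS by auto
  qed
  obtain x0 where x0: "x0 \<in> S" using ne S by blast
  define g where "g t = (if Good t then inv_into S f t else x0)" for t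
  have inj: "inj_on f S" using f_inj by (auto simp: inj_on_def)
  have gf: "g (f x) = x" if "x \<in> S" for x
    using Good_f[OF that] inv_into_f_f[OF inj that] by (simp add: g_def)
  have g_S: "g t \<in> S" for t
  proof (cases "Good t")
    case True
    then obtain x where "x \<in> S" "f x = t" using Good_imp by blast
    then show ?thesis using gf by metis
  qed (use x0 in \<open>simp add: g_def\<close>)
  have "g \<in> borel \<rightarrow>\<^sub>M M"
  proof (rule measurable_sigma_sets[OF X(4)])
    show "{U. openin X U} \<subseteq> Pow (topspace X)" using openin_subset by auto
    show "g \<in> space borel \<rightarrow> topspace X" using g_S X(3) S by auto
    fix V assume "V \<in> {U. openin X U}"
    then have V: "openin X V" by simp
    have "g -` V \<inter> space borel = {t \<in> space borel. (Good t \<and> (\<exists>k\<in>{k. U k \<subseteq> V}. ternary_digit t k)) \<or>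
        (\<not> Good t \<and> x0 \<in> V)}"
    proof -
      have "g t \<in> V \<longleftrightarrow> (Good t \<and> (\<exists>k\<in>{k. U k \<subseteq> V}. ternary_digit t k)) \<or> (\<not> Good t \<and> x0 \<in> V)" for t
      proof (cases "Good t")
        case True
        then obtain x where x: "x \<in> S" "f x = t" using Good_imp by blast
        then have "g t \<in> V \<longleftrightarrow> (\<exists>k\<in>{k. U k \<subseteq> V}. ternary_digit t k)"
          using gf[OF x(1)] digit_f[of x] U_base[OF V, of x] by auto
        then show ?thesis using True by simp
      qed (simp add: g_def)
      then show ?thesis by blast
    qed
    also have "\<dots> \<in> sets borel" by measurable
    finally show "g -` V \<inter> space borel \<in> sets borel" .
  qed
  then show thesis using that[OF f_meas, of g] gf S by blast
qed

section \<open>Isomorphism of atomless standard probability spaces\<close>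

text \<open>
  The maps are total and measurable everywhere; only the equations between them hold almost
  everywhere. This avoids choosing conull subspaces.
\<close>

definition mod0_isomorphism :: "'a measure \<Rightarrow> 'b measure \<Rightarrow> ('a \<Rightarrow> 'b) \<Rightarrow> ('b \<Rightarrow> 'a) \<Rightarrow> bool" where
  "mod0_isomorphism M N p q \<longleftrightarrow> p \<in> M \<rightarrow>\<^sub>M N \<and> q \<in> N \<rightarrow>\<^sub>M M \<and> distr M N p = N \<and> distr N M q = M \<and>
     (AE x in M. q (p x) = x) \<and> (AE y in N. p (q y) = y)"

abbreviation unit_interval :: "real measure" where
  "unit_interval \<equiv> restrict_space lborel {0<..<1}"

lemma mod0_isomorphism_sym: "mod0_isomorphism M N p q \<Longrightarrow> mod0_isomorphism N M q p"
  by (auto simp: mod0_isomorphism_def)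

lemma mod0_isomorphism_trans:
  assumes pq: "mod0_isomorphism L M p q" and rs: "mod0_isomorphism M N r s"
  shows "mod0_isomorphism L N (r \<circ> p) (q \<circ> s)"
proof -
  have [measurable]: "p \<in> L \<rightarrow>\<^sub>M M" "q \<in> M \<rightarrow>\<^sub>M L" "r \<in> M \<rightarrow>\<^sub>M N" "s \<in> N \<rightarrow>\<^sub>M M"
    and d: "distr L M p = M" "distr M L q = L" "distr M N r = N" "distr N M s = M"
    and ae: "AE x in L. q (p x) = x" "AE x in M. p (q x) = x" "AE x in M. s (r x) = x" "AE x in N. r (s x) = x"
    using pq rs by (auto simp: mod0_isomorphism_def)
  have "AE x in distr L M p. s (r x) = x" unfolding d by (rule ae(3))
  then have "AE x in L. s (r (p x)) = p x" by (rule AE_distrD[rotated]) measurable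
  then have 1: "AE x in L. q (s (r (p x))) = x" using ae(1) by eventually_elim simp
  have "AE x in distr N M s. p (q x) = x" unfolding d by (rule ae(2))
  then have "AE x in N. p (q (s x)) = s x" by (rule AE_distrD[rotated]) measurable
  then have 2: "AE x in N. r (p (q (s x))) = x" using ae(4) by eventually_elim simp
  have 3: "distr L N (r \<circ> p) = N" by (subst distr_distr[symmetric, where N = M]) (simp_all add: d)
  have 4: "distr N L (q \<circ> s) = L" by (subst distr_distr[symmetric, where N = M]) (simp_all add: d)
  show ?thesis using 1 2 3 4 by (simp add: mod0_isomorphism_def)
qed

text \<open>
  For a measure that is an image under \<open>p\<close>, an almost everywhere left inverse of \<open>p\<close> is also an
  almost everywhere right inverse. The measure \<open>M\<close> has to be standard for the set where the
  second equation holds to be measurable.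
\<close>

lemma mod0_isomorphismI:
  assumes p: "p \<in> L \<rightarrow>\<^sub>M M" and q: "q \<in> M \<rightarrow>\<^sub>M L" and d: "distr L M p = M"
    and ae: "AE x in L. q (p x) = x" and std: "standard_borel M"
  shows "mod0_isomorphism L M p q"
proof -
  have "{y \<in> space M. p (q y) = y} \<in> sets M"
    using equal_measurable[OF std measurable_compose[OF q p] measurable_ident_sets[OF refl]] by simp
  moreover have "AE x in L. p (q (p x)) = p x" using ae by eventually_elim simp
  ultimately have "AE y in distr L M p. p (q y) = y" by (simp add: AE_distr_iff[OF p])
  then have 1: "AE y in M. p (q y) = y" by (unfold d)
  have "distr M L q = distr (distr L M p) L q" by (simp add: d)
  also have "\<dots> = distr L L (q \<circ> p)" by (rule distr_distr[OF q p])
  also have "\<dots> = distr L L (\<lambda>x. x)"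
    by (rule distr_cong_AE) (use ae p q in \<open>auto intro: measurable_comp\<close>)
  also have "\<dots> = L" by simp
  finally show ?thesis using assms 1 by (simp add: mod0_isomorphism_def)
qed

text \<open>
  Embed \<open>M\<close> into the line and let \<open>\<nu>\<close> be the image measure. Its quantile function \<open>K\<close> carries the
  uniform distribution to \<open>\<nu>\<close>. As \<open>\<nu>\<close> has no atoms, its distribution function is continuous and
  therefore undoes \<open>K\<close> on the open unit interval.
\<close>

lemma mod0_isomorphism_unit_interval:
  assumes "prob_space M" and std: "standard_borel M" and atomless: "\<forall>x\<in>space M. emeasure M {x} = 0"
  obtains p q where "mod0_isomorphism unit_interval M p q"
proof -
  interpret prob_space M by (rule assms)
  obtain f :: "'a \<Rightarrow> real" and g where f [measurable]: "f \<in> M \<rightarrow>\<^sub>M borel"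
    and g [measurable]: "g \<in> borel \<rightarrow>\<^sub>M M" and gf: "\<And>x. x \<in> space M \<Longrightarrow> g (f x) = x"
    using standard_borel_embedding[OF std not_empty] by blast
  define \<nu> where "\<nu> = distr M borel f"
  interpret \<nu>: cdf_distribution \<nu>
    unfolding cdf_distribution_def \<nu>_def by (rule real_distribution_distr) measurable
  have atom: "measure \<nu> {t} = 0" for t
  proof -
    have "emeasure M (f -` {t} \<inter> space M) = 0"
    proof (cases "f -` {t} \<inter> space M = {}")
      case False
      then obtain x where x: "x \<in> space M" "f x = t" by blast
      then have "f -` {t} \<inter> space M = {x}" using gf by (auto; metis)
      then show ?thesis using atomless x by simp
    qed simp
    then show ?thesis by (simp add: \<nu>_def measure_def emeasure_distr)
  qed
  define K where "K \<omega> = Inf {x. \<omega> \<le> cdf \<nu> x}" for \<omega>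
  have K_meas: "K \<in> unit_interval \<rightarrow>\<^sub>M borel"
    unfolding K_def using \<nu>.measurable_CI by (simp add: measurable_def space_restrict_space sets_restrict_space)
  have K_distr: "distr unit_interval borel K = \<nu>" unfolding K_def by (rule \<nu>.distr_I_eq_M)
  have CK: "cdf \<nu> (K \<omega>) = \<omega>" if \<omega>: "0 < \<omega>" "\<omega> < 1" for \<omega>
  proof (rule antisym)
    show "\<omega> \<le> cdf \<nu> (K \<omega>)" using \<nu>.pseudoinverse[OF \<omega>, of "K \<omega>"] by (simp add: K_def)
    have "cdf \<nu> x < \<omega>" if "x < K \<omega>" for x
      using \<nu>.pseudoinverse[OF \<omega>, of x] that by (simp add: K_def not_le[symmetric])
    then have "eventually (\<lambda>x. cdf \<nu> x \<le> \<omega>) (at_left (K \<omega>))"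
      by (auto simp: eventually_at_left_field intro!: exI[of _ "K \<omega> - 1"] less_imp_le)
    moreover have "(cdf \<nu> \<longlongrightarrow> cdf \<nu> (K \<omega>)) (at_left (K \<omega>))"
      using \<nu>.isCont_cdf[of "K \<omega>"] atom by (auto simp: isCont_def intro: tendsto_within_subset)
    ultimately show "cdf \<nu> (K \<omega>) \<le> \<omega>" by (intro tendsto_upperbound) auto
  qed
  \<comment> \<open>The value 1/2 only keeps the map inside the open interval; it is taken on a null set.\<close>
  define q where "q x = (if 0 < cdf \<nu> (f x) \<and> cdf \<nu> (f x) < 1 then cdf \<nu> (f x) else 1/2)" for x
  have q: "q \<in> M \<rightarrow>\<^sub>M unit_interval"
  proof (rule measurable_restrict_space2)
    show "q \<in> space M \<rightarrow> {0<..<1}" by (auto simp: q_def)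
    have [measurable]: "(\<lambda>x. cdf \<nu> (f x)) \<in> borel_measurable M"
      by (rule measurable_compose[OF f \<nu>.measurable_C])
    show "q \<in> M \<rightarrow>\<^sub>M lborel" unfolding q_def by measurable
  qed
  have p: "g \<circ> K \<in> unit_interval \<rightarrow>\<^sub>M M" using K_meas g by (rule measurable_comp)
  have "AE t in \<nu>. f (g t) = t"
    unfolding \<nu>_def by (subst AE_distr_iff) (auto simp: gf intro!: AE_I2)
  then have "AE t in distr unit_interval borel K. f (g t) = t" by (unfold K_distr)
  then have "AE \<omega> in unit_interval. f (g (K \<omega>)) = K \<omega>" by (rule AE_distrD[OF K_meas])
  then have 1: "AE \<omega> in unit_interval. q ((g \<circ> K) \<omega>) = \<omega>"
    using AE_space by eventually_elim (auto simp: q_def CK space_restrict_space)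
  have "distr unit_interval M (g \<circ> K) = distr (distr unit_interval borel K) M g"
    by (rule distr_distr[symmetric, OF g K_meas])
  also have "\<dots> = distr M M (g \<circ> f)" unfolding K_distr \<nu>_def by (rule distr_distr[OF g f])
  also have "\<dots> = distr M M (\<lambda>x. x)" by (rule distr_cong) (auto simp: gf)
  finally have 2: "distr unit_interval M (g \<circ> K) = M" by simp
  show thesis using that[OF mod0_isomorphismI[OF p q 2 1 std]] .
qed

section \<open>Existence of free actions\<close>

text \<open>
  The maps \<open>q \<circ> \<beta> g \<circ> p\<close> satisfy the laws of an action only where \<open>p\<close> and \<open>q\<close> are mutually inverse.
  So let \<open>Z2\<close> be the set of points whose whole orbit lies in the good set. It is invariant and
  conull. On the corresponding conull set of \<open>M\<close> the formula defines an action, and the remaining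
  null set is fixed pointwise.
\<close>

lemma transport_free_action:
  assumes iso: "mod0_isomorphism M Z p q" and act: "free_pmp_action Z G \<beta>"
    and M: "prob_space M" "standard_borel M"
  shows "\<exists>\<alpha>. free_pmp_action M G \<alpha>"
proof -
  interpret Z: free_pmp_action Z G \<beta> by (rule act)
  have p [measurable]: "p \<in> M \<rightarrow>\<^sub>M Z" and q [measurable]: "q \<in> Z \<rightarrow>\<^sub>M M"
    and dp: "distr M Z p = Z" and dq: "distr Z M q = M"
    and qp: "AE x in M. q (p x) = x" and pq: "AE z in Z. p (q z) = z"
    using iso by (auto simp: mod0_isomorphism_def)
  define Z1 where "Z1 = {z \<in> space Z. p (q z) = z}"
  define Z2 where "Z2 = {z \<in> space Z. \<forall>g\<in>carrier G. \<beta> g z \<in> Z1}"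
  define M1 where "M1 = {x \<in> space M. q (p x) = x}"
  define M2 where "M2 = {x \<in> M1. p x \<in> Z2}"
  have Z1s: "Z1 \<in> sets Z"
    unfolding Z1_def by (rule equal_measurable[OF Z.standard]) (use p q in \<open>auto intro: measurable_compose\<close>)
  have M1s: "M1 \<in> sets M"
    unfolding M1_def by (rule equal_measurable[OF M(2)]) (use p q in \<open>auto intro: measurable_compose\<close>)
  have Z2s: "Z2 \<in> sets Z"
  proof -
    have "Z2 = (\<Inter>g\<in>carrier G. \<beta> g -` Z1 \<inter> space Z)" using Z.one_closed by (auto simp: Z2_def)
    also have "\<dots> \<in> sets Z"
      using measurable_sets[OF Z.act_measurable Z1s] Z.countable_group Z.one_closed
      by (intro sets.countable_INT') auto
    finally show ?thesis .
  qed
  have M2_eq: "M2 = M1 \<inter> (p -` Z2 \<inter> space M)" by (auto simp: M2_def M1_def)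
  have M2s: "M2 \<in> sets M" unfolding M2_eq using M1s measurable_sets[OF p Z2s] by (rule sets.Int)
  have M2sp: "x \<in> space M" if "x \<in> M2" for x using that by (simp add: M2_def M1_def)
  have pM2: "p x \<in> Z2" "q (p x) = x" if "x \<in> M2" for x using that by (simp_all add: M2_def M1_def)
  have Z2sp: "z \<in> space Z" if "z \<in> Z2" for z using that by (simp add: Z2_def)
  have Z2act: "\<beta> g z \<in> Z2" if "z \<in> Z2" "g \<in> carrier G" for z g
  proof -
    have "\<beta> h (\<beta> g z) \<in> Z1" if "h \<in> carrier G" for h
    proof -
      have "\<beta> (h \<otimes>\<^bsub>G\<^esub> g) z \<in> Z1" using \<open>z \<in> Z2\<close> \<open>g \<in> carrier G\<close> that by (simp add: Z2_def)
      then show ?thesis using Z.composition_rule Z2sp \<open>z \<in> Z2\<close> \<open>g \<in> carrier G\<close> that by simp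
    qed
    then show ?thesis using Z.element_image[OF that(2) Z2sp[OF that(1)] refl] by (simp add: Z2_def)
  qed
  have Z2Z1: "z \<in> Z1" if "z \<in> Z2" for z
    using that Z.act_one[OF Z2sp[OF that]] Z.one_closed unfolding Z2_def by force
  have pq': "p (q z) = z" if "z \<in> Z2" for z using Z2Z1[OF that] by (simp add: Z1_def)
  have qZ2: "q z \<in> M2" if "z \<in> Z2" for z
    using pq'[OF that] that measurable_space[OF q Z2sp[OF that]] by (simp add: M2_def M1_def)
  have AEZ2: "AE z in Z. z \<in> Z2"
  proof -
    have "AE z in Z. z \<in> Z1" using pq AE_space by eventually_elim (simp add: Z1_def)
    from Z.AE_translates[OF this] AE_space show ?thesis by eventually_elim (simp add: Z2_def)
  qed
  have AEM2: "AE x in M. x \<in> M2"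
  proof -
    have "AE z in distr M Z p. z \<in> Z2" unfolding dp by (rule AEZ2)
    then have "AE x in M. p x \<in> Z2" by (rule AE_distrD[OF p])
    then show ?thesis using qp AE_space by eventually_elim (simp add: M2_def M1_def)
  qed
  define \<alpha> where "\<alpha> g = (\<lambda>x\<in>space M. if x \<in> M2 then q (\<beta> g (p x)) else x)" for g
  have \<alpha>M2: "\<alpha> g x = q (\<beta> g (p x))" if "x \<in> M2" for g x using that M2sp by (simp add: \<alpha>_def)
  have \<alpha>N2: "\<alpha> g x = x" if "x \<in> space M" "x \<notin> M2" for g x using that by (simp add: \<alpha>_def)
  have p\<alpha>: "p (\<alpha> g x) = \<beta> g (p x)" and \<alpha>in: "\<alpha> g x \<in> M2" if "x \<in> M2" "g \<in> carrier G" for g x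
    using \<alpha>M2 that pM2 Z2act pq' qZ2 by simp_all
  have \<alpha>sp: "\<alpha> g x \<in> space M" if "x \<in> space M" "g \<in> carrier G" for g x
    using that \<alpha>in M2sp \<alpha>N2 by (cases "x \<in> M2") simp_all
  have \<alpha>mult: "\<alpha> (g \<otimes>\<^bsub>G\<^esub> h) x = \<alpha> g (\<alpha> h x)" if "x \<in> space M" "g \<in> carrier G" "h \<in> carrier G" for g h x
  proof (cases "x \<in> M2")
    case True
    then show ?thesis
      using that \<alpha>M2 \<alpha>in p\<alpha> Z.composition_rule[OF Z2sp[OF pM2(1)]] by simp
  qed (use that \<alpha>N2 in simp)
  have \<alpha>one: "\<alpha> \<one>\<^bsub>G\<^esub> x = x" if "x \<in> space M" for x
    using that \<alpha>M2 \<alpha>N2 pM2 Z.act_one Z2sp by (cases "x \<in> M2") simp_all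
  have Bij: "\<alpha> g \<in> Bij (space M)" if g: "g \<in> carrier G" for g
  proof -
    have "bij_betw (\<alpha> g) (space M) (space M)"
    proof (rule bij_betw_byWitness[where f' = "\<alpha> (inv\<^bsub>G\<^esub> g)"])
      show "\<forall>x\<in>space M. \<alpha> (inv\<^bsub>G\<^esub> g) (\<alpha> g x) = x"
        using \<alpha>mult[symmetric] \<alpha>one g by simp
      show "\<forall>x\<in>space M. \<alpha> g (\<alpha> (inv\<^bsub>G\<^esub> g) x) = x"
        using \<alpha>mult[symmetric] \<alpha>one g by simp
    qed (use \<alpha>sp g in auto)
    then show ?thesis by (simp add: Bij_def \<alpha>_def)
  qed
  have "group_action G (space M) \<alpha>"
  proof (intro group_action.intro group_hom.intro group_hom_axioms.intro homI)
    show "group G" by (rule Z.is_group)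
    show "group (BijGroup (space M))" by (rule group_BijGroup)
    fix g assume g: "g \<in> carrier G"
    show "\<alpha> g \<in> carrier (BijGroup (space M))" using Bij[OF g] by (simp add: BijGroup_def)
    fix h assume h: "h \<in> carrier G"
    have "\<alpha> (g \<otimes>\<^bsub>G\<^esub> h) = compose (space M) (\<alpha> g) (\<alpha> h)"
    proof (rule extensionalityI[of _ "space M"])
      show "\<alpha> (g \<otimes>\<^bsub>G\<^esub> h) \<in> extensional (space M)" by (simp add: \<alpha>_def)
    qed (simp_all add: \<alpha>mult g h compose_eq)
    then show "\<alpha> (g \<otimes>\<^bsub>G\<^esub> h) = \<alpha> g \<otimes>\<^bsub>BijGroup (space M)\<^esub> \<alpha> h"
      using Bij g h by (simp add: BijGroup_def)
  qed
  moreover have "measure_preserving M M (\<alpha> g)" if g: "g \<in> carrier G" for g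
  proof -
    have [measurable]: "\<beta> g \<in> Z \<rightarrow>\<^sub>M Z" by (rule Z.act_measurable[OF g])
    have [measurable]: "M2 \<in> sets M" by (rule M2s)
    have "(\<lambda>x. if x \<in> M2 then q (\<beta> g (p x)) else x) \<in> M \<rightarrow>\<^sub>M M" by measurable
    then have 1 [measurable]: "\<alpha> g \<in> M \<rightarrow>\<^sub>M M"
      by (rule measurable_cong[THEN iffD1, rotated]) (simp add: \<alpha>_def)
    have "distr M M (\<alpha> g) = distr M M (\<lambda>x. q (\<beta> g (p x)))"
      by (rule distr_cong_AE) (use AEM2 in \<open>auto simp: \<alpha>M2\<close>)
    also have "\<dots> = distr (distr M Z p) M (q \<circ> \<beta> g)" by (subst distr_distr) (auto simp: comp_def)
    also have "\<dots> = distr (distr Z Z (\<beta> g)) M q" unfolding dp by (subst distr_distr) auto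
    also have "\<dots> = M" by (simp add: Z.act_distr[OF g] dq)
    finally show ?thesis using 1 by (simp add: measure_preserving_def)
  qed
  moreover have "AE x in M. stabilizer G \<alpha> x = {\<one>\<^bsub>G\<^esub>}"
  proof -
    have "AE z in distr M Z p. stabilizer G \<beta> z = {\<one>\<^bsub>G\<^esub>}"
      unfolding dp using Z.free by (simp add: essentially_free_def)
    then have "AE x in M. stabilizer G \<beta> (p x) = {\<one>\<^bsub>G\<^esub>}" by (rule AE_distrD[OF p])
    then show ?thesis
      using AEM2
    proof eventually_elim
      fix x assume st: "stabilizer G \<beta> (p x) = {\<one>\<^bsub>G\<^esub>}" and x: "x \<in> M2"
      have "stabilizer G \<alpha> x \<subseteq> stabilizer G \<beta> (p x)"
        using p\<alpha>[OF x] by (force simp: stabilizer_def)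
      moreover have "\<one>\<^bsub>G\<^esub> \<in> stabilizer G \<alpha> x" using \<alpha>one M2sp[OF x] by (simp add: stabilizer_def)
      ultimately show "stabilizer G \<alpha> x = {\<one>\<^bsub>G\<^esub>}" using st by blast
    qed
  qed
  ultimately have "free_pmp_action M G \<alpha>"
    using M Z.countable_group
    by (simp add: free_pmp_action_def free_pmp_action_axioms_def mp_action_def essentially_free_def)
  then show ?thesis by blast
qed

abbreviation uniform_real :: "real measure" where
  "uniform_real \<equiv> uniform_measure lborel {0..1}"

lemma prob_space_uniform_real: "prob_space uniform_real"
  by (rule prob_space_uniform_measure) auto

lemma emeasure_uniform_real: "A \<in> sets borel \<Longrightarrow> emeasure uniform_real A = emeasure lborel ({0..1} \<inter> A)"
  by (subst emeasure_uniform_measure) (auto simp: divide_ennreal_def)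

text \<open>
  A product of copies of the uniform distribution rather than of a finite one: two distinct
  coordinates then differ almost surely, which is all that freeness of the shift needs.
\<close>

abbreviation bernoulli_space :: "(nat \<Rightarrow> real) measure" where
  "bernoulli_space \<equiv> (\<Pi>\<^sub>M i\<in>UNIV. uniform_real)"

lemma space_bernoulli: "space bernoulli_space = UNIV"
  by (simp add: space_PiM)

lemma sets_bernoulli: "sets bernoulli_space = sets borel"
proof -
  have "sets bernoulli_space = sets (\<Pi>\<^sub>M i\<in>(UNIV :: nat set). (borel :: real measure))"
    by (rule sets_PiM_cong) auto
  then show ?thesis by (simp add: sets_PiM_equal_borel)
qed

lemma standard_borel_bernoulli: "standard_borel bernoulli_space"
  unfolding standard_borel_def
proof (intro exI[of _ "euclidean :: (nat \<Rightarrow> real) topology"] conjI)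
  show "completely_metrizable_space (euclidean :: (nat \<Rightarrow> real) topology)"
    by (rule completely_metrizable_space_euclidean)
  obtain B :: "(nat \<Rightarrow> real) set set" where B: "countable B" "topological_basis B"
    using ex_countable_basis by blast
  show "second_countable (euclidean :: (nat \<Rightarrow> real) topology)"
    unfolding second_countable_def
  proof (intro exI[of _ B] conjI allI impI ballI)
    fix V assume "V \<in> B" then show "openin euclidean V" using B topological_basis_open by simp
  next
    fix U :: "(nat \<Rightarrow> real) set" and x assume "openin euclidean U \<and> x \<in> U"
    then have "open U" "x \<in> U" by simp_all
    from topological_basisE[OF B(2) this] show "\<exists>V\<in>B. x \<in> V \<and> V \<subseteq> U" by metis
  qed (rule B(1))
  show "topspace euclidean = space bernoulli_space" by (simp add: space_bernoulli)
  show "sets bernoulli_space = sigma_sets (topspace euclidean) {U. openin euclidean U}"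
    by (simp add: sets_bernoulli borel_def)
qed

lemma emeasure_uniform_real_interval:
  assumes "0 < n"
  shows "emeasure uniform_real {real k / real n..<real (Suc k) / real n} \<le> ennreal (1 / real n)"
proof -
  have "emeasure uniform_real {real k / real n..<real (Suc k) / real n}
      \<le> emeasure lborel {real k / real n..<real (Suc k) / real n}"
    by (subst emeasure_uniform_real) (auto intro: emeasure_mono)
  also have "\<dots> = ennreal (1 / real n)" using assms by (simp add: field_simps)
  finally show ?thesis .
qed

interpretation bernoulli: product_prob_space "\<lambda>_ :: nat. uniform_real" UNIV
  by (intro product_prob_spaceI prob_space_uniform_real)

text \<open>
  Divide the unit interval into intervals of length \<open>1/n\<close>. Equal coordinates lie in the same one of
  them, and two independent coordinates do so in a given one with probability at most \<open>1/n\<^sup>2\<close>.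
\<close>

lemma AE_bernoulli_coordinates_ne:
  assumes "i \<noteq> (j :: nat)"
  shows "AE z in bernoulli_space. z i \<noteq> z j"
proof -
  have m [measurable]: "(\<lambda>z. z k) \<in> borel_measurable bernoulli_space" for k :: nat
    using measurable_component_singleton[of k UNIV "\<lambda>_. uniform_real"] by simp
  let ?D = "{z \<in> space bernoulli_space. z i = z j}"
  have D: "?D \<in> sets bernoulli_space" by measurable
  have unit: "AE z in bernoulli_space. z k \<in> {0..1}" for k :: nat
  proof -
    have "emeasure bernoulli_space {z \<in> space bernoulli_space. z k \<in> - {0..1}} = emeasure uniform_real (- {0..1})"
      by (rule bernoulli.emeasure_PiM_Collect_single) auto
    also have "\<dots> = 0" by (subst emeasure_uniform_real) auto
    finally show ?thesis by (subst AE_iff_measurable[OF _ refl]) (auto simp: Compl_eq)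
  qed
  have le: "emeasure bernoulli_space ?D \<le> ennreal (2 / real n)" if n: "0 < n" for n :: nat
  proof -
    let ?J = "\<lambda>k. {real k / real n..<real (Suc k) / real n}"
    let ?C = "\<lambda>k. {z \<in> space bernoulli_space. \<forall>l\<in>{i, j}. z l \<in> ?J k}"
    \<comment> \<open>Indices up to n, not n - 1: the value 1 lies in the half-open interval with index n.\<close>
    have "AE z in bernoulli_space. z \<in> ?D \<longrightarrow> z \<in> (\<Union>k\<in>{..n}. ?C k)"
      using unit[of i]
    proof eventually_elim
      fix z :: "nat \<Rightarrow> real" assume z: "z i \<in> {0..1}"
      define k where "k = nat \<lfloor>z i * real n\<rfloor>"
      have nn: "0 \<le> z i * real n" using z by simp
      have k: "real k \<le> z i * real n" "z i * real n < real k + 1"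
        unfolding k_def using nn by linarith+
      have "z i * real n \<le> real n" using z n by (simp add: mult_left_le_one_le)
      then have "k \<le> n" using k(1) by linarith
      moreover have "z i \<in> ?J k" using k n by (simp add: field_simps)
      ultimately show "z \<in> ?D \<longrightarrow> z \<in> (\<Union>k\<in>{..n}. ?C k)" by (auto simp: space_bernoulli)
    qed
    moreover have C: "?C k \<in> sets bernoulli_space" for k by measurable
    ultimately have "emeasure bernoulli_space ?D \<le> emeasure bernoulli_space (\<Union>k\<in>{..n}. ?C k)"
      by (intro emeasure_mono_AE) auto
    also have "\<dots> \<le> (\<Sum>k\<le>n. emeasure bernoulli_space (?C k))"
      using C by (intro emeasure_subadditive_finite) auto
    also have "\<dots> \<le> (\<Sum>k\<le>n. ennreal (1 / real n) * ennreal (1 / real n))"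
    proof (rule sum_mono)
      fix k
      have "emeasure bernoulli_space (?C k) = (\<Prod>l\<in>{i, j}. emeasure uniform_real (?J k))"
        by (rule bernoulli.emeasure_PiM_Collect) auto
      also have "\<dots> \<le> ennreal (1 / real n) * ennreal (1 / real n)"
        using emeasure_uniform_real_interval[OF n] assms by (auto intro: mult_mono)
      finally show "emeasure bernoulli_space (?C k) \<le> ennreal (1 / real n) * ennreal (1 / real n)" .
    qed
    also have "\<dots> = ennreal (\<Sum>k\<le>n. 1 / real n * (1 / real n))"
      by (simp add: ennreal_mult[symmetric] del: sum_constant) 
    also have "\<dots> \<le> ennreal (2 / real n)"
      using n by (intro ennreal_leI) (simp add: field_simps)
    finally show ?thesis .
  qed
  have "emeasure bernoulli_space ?D \<le> 0 + ennreal e" if e: "0 < e" for e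
  proof -
    obtain n :: nat where n: "2 / e < real n" using reals_Archimedean2 by blast
    moreover have "0 < 2 / e" using e by simp
    ultimately have n0: "0 < real n" by linarith
    have "2 / real n \<le> e" using n n0 e by (simp add: field_simps)
    then show ?thesis using le[of n] n0 by (auto intro: order_trans ennreal_leI)
  qed
  then have "emeasure bernoulli_space ?D \<le> 0" by (rule ennreal_le_epsilon)
  then have "emeasure bernoulli_space ?D = 0" by simp
  then show ?thesis by (subst AE_iff_measurable[OF D]) simp_all
qed

lemma bernoulli_atomless: "emeasure bernoulli_space {z} = 0"
proof -
  have [measurable]: "(\<lambda>w. w 0) \<in> borel_measurable bernoulli_space"
    using measurable_component_singleton[of "0::nat" UNIV "\<lambda>_. uniform_real"] by simp
  have "{w \<in> space bernoulli_space. w 0 \<in> {z 0}} \<in> sets bernoulli_space" by measurable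
  then have "emeasure bernoulli_space {z} \<le> emeasure bernoulli_space {w \<in> space bernoulli_space. w 0 \<in> {z 0}}"
    by (rule emeasure_mono[rotated]) (simp add: space_bernoulli)
  also have "\<dots> = emeasure uniform_real {z 0}"
    by (rule bernoulli.emeasure_PiM_Collect_single) auto
  also have "\<dots> = emeasure lborel ({0..1} \<inter> {z 0})" by (rule emeasure_uniform_real) simp
  also have "\<dots> \<le> emeasure lborel {z 0}" by (rule emeasure_mono) auto
  also have "\<dots> = 0" by simp
  finally show ?thesis by (simp only: le_zero_eq)
qed

text \<open>
  The shift on functions on \<open>G\<close>, with \<open>G\<close> enumerated by the natural numbers. If \<open>g\<close> fixes \<open>z\<close>, then
  the coordinates of \<open>z\<close> at \<open>g\<close> and at the neutral element agree, a null event unless \<open>g\<close> is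
  neutral.
\<close>

lemma bernoulli_shift_free:
  assumes G: "group G" and ct: "countable (carrier G)" and inf: "infinite (carrier G)"
  shows "\<exists>\<beta>. free_pmp_action bernoulli_space G \<beta>"
proof -
  interpret group G by (rule G)
  define e where "e = from_nat_into (carrier G)"
  define n where "n = to_nat_on (carrier G)"
  have ec: "e i \<in> carrier G" for i unfolding e_def by (rule from_nat_into) (use one_closed in auto)
  have en: "e (n g) = g" if "g \<in> carrier G" for g unfolding e_def n_def using ct that by simp
  have ne: "n (e i) = i" for i unfolding e_def n_def using ct inf by simp
  define \<sigma> where "\<sigma> g i = n (inv\<^bsub>G\<^esub> g \<otimes>\<^bsub>G\<^esub> e i)" for g i
  define \<beta> where "\<beta> g z = (\<lambda>i. z (\<sigma> g i))" for g and z :: "nat \<Rightarrow> real"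
  have \<sigma>mult: "\<sigma> h (\<sigma> g i) = \<sigma> (g \<otimes>\<^bsub>G\<^esub> h) i" if "g \<in> carrier G" "h \<in> carrier G" for g h i
    using that ec by (simp add: \<sigma>_def en inv_mult_group m_assoc)
  have \<sigma>one: "\<sigma> \<one>\<^bsub>G\<^esub> i = i" for i using ec by (simp add: \<sigma>_def ne)
  have \<sigma>inj: "inj (\<sigma> g)" if "g \<in> carrier G" for g
    using \<sigma>mult[of "g" "inv\<^bsub>G\<^esub> g"] \<sigma>one that by (metis inj_on_inverseI inv_closed r_inv)
  have \<beta>mult: "\<beta> (g \<otimes>\<^bsub>G\<^esub> h) z = \<beta> g (\<beta> h z)" if "g \<in> carrier G" "h \<in> carrier G" for g h z
    using that by (simp add: \<beta>_def \<sigma>mult)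
  have \<beta>one: "\<beta> \<one>\<^bsub>G\<^esub> z = z" for z by (simp add: \<beta>_def \<sigma>one)
  have Bij: "\<beta> g \<in> Bij UNIV" if g: "g \<in> carrier G" for g
  proof -
    have "bij (\<beta> g)"
      by (rule bij_betw_byWitness[where f' = "\<beta> (inv\<^bsub>G\<^esub> g)"]) (simp_all add: \<beta>mult[symmetric] g \<beta>one)
    then show ?thesis by (simp add: Bij_def)
  qed
  have "group_action G UNIV \<beta>"
  proof (intro group_action.intro group_hom.intro group_hom_axioms.intro homI)
    fix g assume g: "g \<in> carrier G"
    show "\<beta> g \<in> carrier (BijGroup UNIV)" using Bij[OF g] by (simp add: BijGroup_def)
    fix h assume h: "h \<in> carrier G"
    show "\<beta> (g \<otimes>\<^bsub>G\<^esub> h) = \<beta> g \<otimes>\<^bsub>BijGroup UNIV\<^esub> \<beta> h"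
      using Bij g h by (auto simp: BijGroup_def compose_def \<beta>mult)
  qed (rule G, rule group_BijGroup)
  moreover have "measure_preserving bernoulli_space bernoulli_space (\<beta> g)" if g: "g \<in> carrier G" for g
  proof -
    have "distr bernoulli_space bernoulli_space (\<lambda>z. \<lambda>i\<in>UNIV. z (\<sigma> g i)) = bernoulli_space"
      by (rule distr_PiM_reindex[of UNIV "\<lambda>_. uniform_real" "\<sigma> g" UNIV])
         (use \<sigma>inj[OF g] prob_space_uniform_real in auto)
    moreover have "(\<lambda>z. \<lambda>i\<in>UNIV. z (\<sigma> g i)) \<in> bernoulli_space \<rightarrow>\<^sub>M bernoulli_space"
      by (intro measurable_restrict measurable_component_singleton) simp
    moreover have "\<beta> g = (\<lambda>z. \<lambda>i\<in>UNIV. z (\<sigma> g i))" by (simp add: \<beta>_def fun_eq_iff)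
    ultimately show ?thesis by (simp add: measure_preserving_def)
  qed
  moreover have "AE z in bernoulli_space. stabilizer G \<beta> z = {\<one>\<^bsub>G\<^esub>}"
  proof -
    have "AE z in bernoulli_space. \<forall>g\<in>carrier G. g \<noteq> \<one>\<^bsub>G\<^esub> \<longrightarrow> \<beta> g z \<noteq> z"
    proof (subst AE_ball_countable[OF ct], intro ballI)
      fix g assume g: "g \<in> carrier G"
      show "AE z in bernoulli_space. g \<noteq> \<one>\<^bsub>G\<^esub> \<longrightarrow> \<beta> g z \<noteq> z"
      proof (cases "g = \<one>\<^bsub>G\<^esub>")
        case False
        have "\<sigma> g (n g) = n \<one>\<^bsub>G\<^esub>" using g by (simp add: \<sigma>_def en)
        moreover have "n \<one>\<^bsub>G\<^esub> \<noteq> n g" using en[OF g] en[OF one_closed] False by metis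
        ultimately have "AE z in bernoulli_space. \<beta> g z (n g) \<noteq> z (n g)"
          using AE_bernoulli_coordinates_ne by (simp add: \<beta>_def)
        then show ?thesis by eventually_elim auto
      qed simp
    qed
    then show ?thesis
      by eventually_elim (auto simp: stabilizer_def \<beta>one)
  qed
  ultimately have "free_pmp_action bernoulli_space G \<beta>"
    using ct standard_borel_bernoulli bernoulli.prob_space_axioms
    by (simp add: free_pmp_action_def free_pmp_action_axioms_def mp_action_def essentially_free_def
        space_bernoulli)
  then show ?thesis by blast
qed

lemma exists_free_pmp_action:
  assumes "group G" "countable (carrier G)" "infinite (carrier G)"
    and M: "prob_space M" "standard_borel M" "\<forall>x\<in>space M. emeasure M {x} = 0"
  shows "\<exists>\<alpha>. free_pmp_action M G \<alpha>"
proof -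
  obtain \<beta> where \<beta>: "free_pmp_action bernoulli_space G \<beta>"
    using bernoulli_shift_free assms(1-3) by blast
  obtain p q where pq: "mod0_isomorphism unit_interval M p q"
    using mod0_isomorphism_unit_interval[OF M] .
  obtain r s where rs: "mod0_isomorphism unit_interval bernoulli_space r s"
    by (rule mod0_isomorphism_unit_interval[OF bernoulli.prob_space_axioms standard_borel_bernoulli])
       (simp add: bernoulli_atomless)
  show ?thesis
    using transport_free_action[OF mod0_isomorphism_trans[OF mod0_isomorphism_sym[OF pq] rs] \<beta> M(1,2)] .
qed

section \<open>Elements of Thompson's group\<close>

text \<open>
  A derivative has the intermediate value property: \<open>f t - m t\<close> attains its minimum on the interval,
  and not at an end point, since its derivative is negative on the left and positive on the right.
\<close>

lemma darboux:
  fixes f h :: "real \<Rightarrow> real"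
  assumes xy: "x < y" and d: "\<And>t. x \<le> t \<Longrightarrow> t \<le> y \<Longrightarrow> (f has_real_derivative h t) (at t)"
    and m: "h x < m" "m < h y"
  shows "\<exists>t. x < t \<and> t < y \<and> h t = m"
proof -
  define k where "k t = f t - m * t" for t
  have dk: "(k has_real_derivative h t - m) (at t)" if "x \<le> t" "t \<le> y" for t
    unfolding k_def using d[OF that] by (auto intro!: derivative_eq_intros)
  have "continuous_on {x..y} k"
    by (intro continuous_at_imp_continuous_on ballI DERIV_isCont[OF dk]) auto
  then obtain t where t: "t \<in> {x..y}" "\<And>s. s \<in> {x..y} \<Longrightarrow> k t \<le> k s"
    using continuous_attains_inf[of "{x..y}" k] xy by auto
  have "t \<noteq> x"
  proof
    assume "t = x"
    then obtain e where e: "0 < e" "\<And>s. 0 < s \<Longrightarrow> s < e \<Longrightarrow> k (x + s) < k x"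
      using DERIV_neg_dec_right[OF dk[of x]] xy m by auto
    define s where "s = min (e / 2) (y - x)"
    have "0 < s" "s < e" "x + s \<in> {x..y}" using e(1) xy by (auto simp: s_def)
    then show False using e(2)[of s] t(2)[of "x + s"] \<open>t = x\<close> by simp
  qed
  moreover have "t \<noteq> y"
  proof
    assume "t = y"
    then obtain e where e: "0 < e" "\<And>s. 0 < s \<Longrightarrow> s < e \<Longrightarrow> k (y - s) < k y"
      using DERIV_pos_inc_left[OF dk[of y]] xy m by auto
    define s where "s = min (e / 2) (y - x)"
    have "0 < s" "s < e" "y - s \<in> {x..y}" using e(1) xy by (auto simp: s_def)
    then show False using e(2)[of s] t(2)[of "y - s"] \<open>t = y\<close> by simp
  qed
  ultimately have t': "x < t" "t < y" using t(1) by auto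
  have "h t - m = 0"
  proof (rule DERIV_local_min[OF dk])
    show "0 < min (t - x) (y - t)" using t' by simp
    show "\<forall>s. \<bar>t - s\<bar> < min (t - x) (y - t) \<longrightarrow> k t \<le> k s"
    proof (intro allI impI t(2))
      fix s assume "\<bar>t - s\<bar> < min (t - x) (y - t)"
      then have "x \<le> s" "s \<le> y" by linarith+
      then show "s \<in> {x..y}" by simp
    qed
  qed (use t' in auto)
  then show ?thesis using t' by auto
qed

text \<open>
  By the intermediate value property of derivatives the slope cannot change, because it would have to
  pass through a value that is not a power of 2.
\<close>

lemma derivative_powi_imp_affine:
  fixes f :: "real \<Rightarrow> real"
  assumes ab: "a < b" and c: "continuous_on {a..b} f"
    and d: "\<And>x. a < x \<Longrightarrow> x < b \<Longrightarrow> \<exists>n::int. (f has_real_derivative 2 powi n) (at x)"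
  shows "\<exists>(n::int) e. \<forall>x\<in>{a..b}. f x = 2 powi n * x + e"
proof -
  obtain n :: "real \<Rightarrow> int" where n: "\<And>x. a < x \<Longrightarrow> x < b \<Longrightarrow> (f has_real_derivative 2 powi n x) (at x)"
    using d by metis
  \<comment> \<open>The separating value between distinct powers of 2 is 3/2 times the smaller one.\<close>
  have gap: "(2::real) powi i < (3/2) * 2 powi i" "(3/2) * 2 powi i < (2::real) powi j" if "i < j" for i j :: int
  proof -
    have "(2::real) powi (i + 1) \<le> 2 powi j" using that by (intro power_int_increasing) auto
    moreover have "(2::real) powi (i + 1) = 2 * 2 powi i" by (simp add: power_int_add)
    moreover have "0 < (2::real) powi i" by simp
    ultimately show "(3/2) * 2 powi i < (2::real) powi j" by linarith
  qed simp
  have notpow: "(3/2) * 2 powi i \<noteq> (2::real) powi k" for i k :: int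
  proof (cases "k \<le> i")
    case True
    have "(2::real) powi k \<le> 2 powi i" using True by (intro power_int_increasing) auto
    moreover have "0 < (2::real) powi i" by simp
    ultimately show ?thesis by linarith
  next
    case False
    then show ?thesis using gap(2)[of i k] by simp
  qed
  have const: "n x = n y" if xy: "a < x" "x < y" "y < b" for x y
  proof (rule ccontr)
    assume "n x \<noteq> n y"
    then consider "n x < n y" | "n y < n x" by linarith
    then show False
    proof cases
      case 1
      have "\<exists>t. x < t \<and> t < y \<and> 2 powi n t = (3/2) * (2::real) powi n x"
        by (rule darboux[of x y f]) (use xy n gap[OF 1] in auto)
      then show False using notpow by metis
    next
      case 2
      have "\<exists>t. x < t \<and> t < y \<and> - (2 powi n t) = - ((3/2) * (2::real) powi n y)"
        by (rule darboux[of x y "\<lambda>t. - f t"]) (use xy n gap[OF 2] in \<open>auto intro!: DERIV_minus\<close>)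
      then show False using notpow by (metis neg_equal_iff_equal)
    qed
  qed
  define m where "m = n ((a + b) / 2)"
  have nm: "n x = m" if x: "a < x" "x < b" for x
  proof -
    consider "x < (a + b) / 2" | "x = (a + b) / 2" | "(a + b) / 2 < x" by linarith
    then show ?thesis
    proof cases
      case 1
      then show ?thesis unfolding m_def using ab x by (intro const) auto
    next
      case 2
      then show ?thesis unfolding m_def by (rule arg_cong)
    next
      case 3
      then show ?thesis unfolding m_def using ab x by (intro const[symmetric]) auto
    qed
  qed
  have "f x - 2 powi m * x = f a - 2 powi m * a" if "x \<in> {a..b}" for x
  proof (rule DERIV_isconst2[OF ab, of "\<lambda>x. f x - 2 powi m * x"])
    show "continuous_on {a..b} (\<lambda>x. f x - 2 powi m * x)" by (intro continuous_intros c)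
    fix x assume x: "a < x" "x < b"
    have "(f has_real_derivative 2 powi m) (at x)" using n[OF x] nm[OF x] by simp
    then show "((\<lambda>x. f x - 2 powi m * x) has_real_derivative 0) (at x)"
      by (auto intro!: derivative_eq_intros)
  qed (use that in auto)
  then have "\<forall>x\<in>{a..b}. f x = 2 powi m * x + (f a - 2 powi m * a)" by (simp add: algebra_simps)
  then show ?thesis by blast
qed

lemma dyadic_common_denominator:
  assumes "finite D" "D \<subseteq> dyadic_rationals"
  shows "\<exists>N. \<forall>d\<in>D. \<exists>k::int. d = of_int k / 2 ^ N"
  using assms
proof (induction rule: finite_induct)
  case (insert d D)
  then obtain N where N: "\<forall>d\<in>D. \<exists>k::int. d = of_int k / 2 ^ N" by auto
  obtain k :: int and n where d: "d = of_int k / 2 ^ n" using insert.prems by (auto simp: dyadic_rationals_def)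
  have "\<exists>k'::int. of_int k / 2 ^ n = (of_int k' / 2 ^ (n + N) :: real)" for k :: int and n N
    by (rule exI[of _ "k * 2 ^ N"]) (simp add: power_add)
  then have "\<forall>d\<in>insert d D. \<exists>k::int. d = of_int k / 2 ^ (n + N)"
    using N d by (metis add.commute insert_iff)
  then show ?case by blast
qed simp

text \<open>
  The map \<open>f\<close> is affine on all intervals of the dyadic grid of mesh \<open>1/2\<^sup>N\<close>, with the exponents of
  the slopes listed from left to right. The constant terms are left open: they are determined by
  continuity and the value at 0.
\<close>

definition grid_slopes :: "nat \<Rightarrow> int list \<Rightarrow> (real \<Rightarrow> real) \<Rightarrow> bool" where
  "grid_slopes N ns f \<longleftrightarrow>
     (\<forall>k<2 ^ N. \<exists>e. \<forall>x\<in>{real k / 2 ^ N..real (Suc k) / 2 ^ N}. f x = 2 powi (ns ! k) * x + e)"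

text \<open>
  On a grid fine enough to contain all exceptional points the derivative exists everywhere between
  neighbouring grid points.
\<close>

lemma thompson_F_grid_slopes:
  assumes f: "f \<in> carrier thompson_F"
  shows "\<exists>N ns. grid_slopes N ns f"
proof -
  have cont: "continuous_on {0..1} f" using f by (auto simp: thompson_F_def homeomorphism_def)
  obtain D where D: "finite D" "D \<subseteq> dyadic_rationals"
    "\<And>x. x \<in> {0..1} - D \<Longrightarrow> \<exists>n::int. (f has_real_derivative 2 powi n) (at x within {0..1})"
    using f by (auto simp: thompson_F_def)
  obtain N where N: "\<forall>d\<in>D. \<exists>k::int. d = of_int k / 2 ^ N" using dyadic_common_denominator D by blast
  have "\<exists>n::int. \<exists>e. \<forall>x\<in>{real k / 2 ^ N..real (Suc k) / 2 ^ N}. f x = 2 powi n * x + e" if k: "k < 2 ^ N" for k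
  proof (rule derivative_powi_imp_affine)
    show "real k / 2 ^ N < real (Suc k) / 2 ^ N" by (simp add: divide_strict_right_mono)
    have "real (Suc k) \<le> 2 ^ N" using k by (metis Suc_leI of_nat_le_iff of_nat_numeral of_nat_power)
    then have sub: "{real k / 2 ^ N..real (Suc k) / 2 ^ N} \<subseteq> {0..1}"
      by (auto simp: field_simps)
    show "continuous_on {real k / 2 ^ N..real (Suc k) / 2 ^ N} f"
      by (rule continuous_on_subset[OF cont sub])
    fix x assume x: "real k / 2 ^ N < x" "x < real (Suc k) / 2 ^ N"
    have "x \<notin> D"
    proof
      assume "x \<in> D"
      then obtain j :: int where j: "x = of_int j / 2 ^ N" using N by blast
      then have "real k < of_int j" "of_int j < real (Suc k)" using x by (simp_all add: field_simps)
      then have "int k < j" "j < int (Suc k)" by linarith+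
      then show False by simp
    qed
    moreover have "x \<in> {0..1}" using sub x by (meson atLeastAtMost_iff less_imp_le subsetD)
    ultimately obtain n :: int where n: "(f has_real_derivative 2 powi n) (at x within {0..1})"
      using D(3)[of x] by blast
    have "0 < x" "x < 1"
      using x \<open>real (Suc k) \<le> 2 ^ N\<close>
      by (auto intro: le_less_trans[of 0 "real k / 2 ^ N"] less_le_trans[of x "real (Suc k) / 2 ^ N"])
    then have "at x within {0..1} = at x" by (intro at_within_interior) simp
    then show "\<exists>n::int. (f has_real_derivative 2 powi n) (at x)" using n by auto
  qed
  then obtain m :: "nat \<Rightarrow> int" where m:
    "\<And>k. k < 2 ^ N \<Longrightarrow> \<exists>e. \<forall>x\<in>{real k / 2 ^ N..real (Suc k) / 2 ^ N}. f x = 2 powi m k * x + e"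
    by metis
  have "grid_slopes N (map m [0..<2 ^ N]) f" using m by (simp add: grid_slopes_def)
  then show ?thesis by blast
qed

lemma grid_slopesD:
  assumes "grid_slopes N ns f" "k < 2 ^ N"
  shows "\<exists>e. \<forall>x. real k / 2 ^ N \<le> x \<longrightarrow> x \<le> real (Suc k) / 2 ^ N \<longrightarrow> f x = 2 powi (ns ! k) * x + e"
  using assms unfolding grid_slopes_def atLeastAtMost_iff Ball_def by blast

lemma grid_slopes_strict_mono:
  assumes g: "grid_slopes N ns f"
  shows "k \<le> 2 ^ N \<Longrightarrow> 0 \<le> x \<Longrightarrow> x < y \<Longrightarrow> y \<le> real k / 2 ^ N \<Longrightarrow> f x < f y"
proof (induction k arbitrary: x y)
  case (Suc k)
  obtain e where e: "\<And>x. real k / 2 ^ N \<le> x \<Longrightarrow> x \<le> real (Suc k) / 2 ^ N \<Longrightarrow> f x = 2 powi (ns ! k) * x + e"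
    using grid_slopesD[OF g, of k] Suc.prems(1) by auto
  have aff: "f u < f v" if "real k / 2 ^ N \<le> u" "u < v" "v \<le> real (Suc k) / 2 ^ N" for u v
    using e[of u] e[of v] that zero_less_power_int[of "2::real" "ns ! k"] by simp
  consider "y \<le> real k / 2 ^ N" | "real k / 2 ^ N \<le> x" | "x < real k / 2 ^ N" "real k / 2 ^ N < y" by linarith
  then show ?case
  proof cases
    case 3
    have "f x < f (real k / 2 ^ N)" using Suc.IH[of x "real k / 2 ^ N"] Suc.prems 3 by simp
    also have "\<dots> < f y" using aff[of "real k / 2 ^ N" y] 3 Suc.prems by simp
    finally show ?thesis .
  qed (use Suc aff in auto)
qed simp

lemma thompson_F_Bij: "f \<in> carrier thompson_F \<Longrightarrow> f \<in> Bij {0..1}"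
  by (simp add: thompson_F_def)

lemma thompson_F_less:
  assumes f: "f \<in> carrier thompson_F" and xy: "0 \<le> x" "x < y" "y \<le> 1"
  shows "f x < f y"
proof -
  obtain N ns where "grid_slopes N ns f" using thompson_F_grid_slopes[OF f] by blast
  from grid_slopes_strict_mono[OF this, of "2 ^ N" x y] show ?thesis using xy by simp
qed

lemma thompson_F_le:
  assumes "f \<in> carrier thompson_F" "0 \<le> x" "x \<le> y" "y \<le> 1"
  shows "f x \<le> f y"
  using thompson_F_less[OF assms(1), of x y] assms by (cases "x = y") auto

lemma thompson_F_image: "f \<in> carrier thompson_F \<Longrightarrow> f ` {0..1} = {0..1}"
  using thompson_F_Bij[of f] by (simp add: Bij_def bij_betw_def)

lemma thompson_F_endpoints:
  assumes f: "f \<in> carrier thompson_F"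
  shows "f 0 = 0" "f 1 = 1"
proof -
  obtain x where x: "x \<in> {0..1}" "f x = 0" using thompson_F_image[OF f] by (metis atLeastAtMost_iff imageE order_refl zero_le_one)
  obtain y where y: "y \<in> {0..1}" "f y = 1" using thompson_F_image[OF f] by (metis atLeastAtMost_iff imageE order_refl zero_le_one)
  have "f 0 \<in> {0..1}" "f 1 \<in> {0..1}" using thompson_F_image[OF f] by force+
  then show "f 0 = 0" "f 1 = 1"
    using thompson_F_le[OF f, of 0 x] thompson_F_le[OF f, of y 1] x y by auto
qed

lemma grid_slopes_unique:
  assumes f: "grid_slopes N ns f" and g: "grid_slopes N ns g" and 0: "f 0 = g 0"
  shows "k \<le> 2 ^ N \<Longrightarrow> 0 \<le> x \<Longrightarrow> x \<le> real k / 2 ^ N \<Longrightarrow> f x = g x"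
proof (induction k arbitrary: x)
  case (Suc k)
  obtain e where e: "\<And>x. real k / 2 ^ N \<le> x \<Longrightarrow> x \<le> real (Suc k) / 2 ^ N \<Longrightarrow> f x = 2 powi (ns ! k) * x + e"
    using grid_slopesD[OF f, of k] Suc.prems(1) by auto
  obtain e' where e': "\<And>x. real k / 2 ^ N \<le> x \<Longrightarrow> x \<le> real (Suc k) / 2 ^ N \<Longrightarrow> g x = 2 powi (ns ! k) * x + e'"
    using grid_slopesD[OF g, of k] Suc.prems(1) by auto
  have le: "real k / 2 ^ N \<le> real (Suc k) / 2 ^ N" by (simp add: divide_right_mono)
  have "f (real k / 2 ^ N) = g (real k / 2 ^ N)" using Suc.IH[of "real k / 2 ^ N"] Suc.prems by simp
  then have "e = e'" using e[of "real k / 2 ^ N"] e'[of "real k / 2 ^ N"] le by simp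
  then show ?case using Suc.IH[of x] e[of x] e'[of x] Suc.prems by (cases "x \<le> real k / 2 ^ N") auto
qed (use 0 in simp)

text \<open>
  An element is determined by the fineness of a suitable grid and its finitely many slopes.
\<close>

lemma countable_thompson_F: "countable (carrier thompson_F)"
proof -
  define c where "c f = (SOME p. grid_slopes (fst p) (snd p) f)" for f
  have c: "grid_slopes (fst (c f)) (snd (c f)) f" if "f \<in> carrier thompson_F" for f
    unfolding c_def by (rule someI_ex[of "\<lambda>p. grid_slopes (fst p) (snd p) f"])
      (use thompson_F_grid_slopes[OF that] in auto)
  have "inj_on c (carrier thompson_F)"
  proof (rule inj_onI)
    fix f g assume fg: "f \<in> carrier thompson_F" "g \<in> carrier thompson_F" "c f = c g"
    show "f = g"
    proof (rule extensionalityI[of _ "{0..1}"])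
      show "f \<in> extensional {0..1}" "g \<in> extensional {0..1}" using fg thompson_F_Bij by (auto simp: Bij_def)
      fix x :: real assume "x \<in> {0..1}"
      then show "f x = g x"
        using grid_slopes_unique[OF c[OF fg(1)] _ , of g "2 ^ fst (c f)" x] c[OF fg(2)] fg(3)
          thompson_F_endpoints(1)[OF fg(1)] thompson_F_endpoints(1)[OF fg(2)] by simp
    qed
  qed
  then show ?thesis by (rule countable_image_inj_on[rotated]) simp
qed

lemma dyadic_between:
  fixes u v :: real
  assumes "0 \<le> u" "u < v" "v \<le> 1"
  shows "\<exists>i n. u < real i / 2 ^ n \<and> real (i + 4) / 2 ^ n < v \<and> i + 4 \<le> 2 ^ n"
proof -
  obtain n where n: "6 / (v - u) < 2 ^ n" using real_arch_pow[of 2 "6 / (v - u)"] by auto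
  define i where "i = nat \<lfloor>u * 2 ^ n\<rfloor> + 1"
  have "0 \<le> u * 2 ^ n" using assms by simp
  then have i: "u * 2 ^ n < real i" "real i \<le> u * 2 ^ n + 1" unfolding i_def by linarith+
  have "6 < (v - u) * 2 ^ n" using n assms by (simp add: field_simps)
  then have v: "real (i + 4) < v * 2 ^ n" using i by (simp add: algebra_simps)
  also have "\<dots> \<le> 1 * 2 ^ n" using assms by (intro mult_right_mono) auto
  finally have "real (i + 4) < real (2 ^ n)" by simp
  then have "i + 4 \<le> 2 ^ n" by linarith
  then show ?thesis using i v by (intro exI[of _ i] exI[of _ n]) (simp add: field_simps)
qed

text \<open>
  The concave middle part has slopes 2, 1 and 1/2 on intervals of length \<open>d\<close>, \<open>d\<close> and \<open>2 d\<close>, and joins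
  the fixed points \<open>c\<close> and \<open>c + 4 d\<close>. Taking the maximum with the identity gives a homeomorphism
  of the line that moves exactly the points between \<open>c\<close> and \<open>c + 4 d\<close>. With \<open>c = 0\<close> and
  \<open>d = 1/4\<close> it moves all interior points of the unit interval.
\<close>

definition bump :: "real \<Rightarrow> real \<Rightarrow> real \<Rightarrow> real" where
  "bump c d x = max x (min (2 * x - c) (min (x + d) ((x + c + 4 * d) / 2)))"

definition bump_inv :: "real \<Rightarrow> real \<Rightarrow> real \<Rightarrow> real" where
  "bump_inv c d y = min y (max ((y + c) / 2) (max (y - d) (2 * y - c - 4 * d)))"

lemma bump_eqs:
  assumes "0 < d"
  shows "x \<le> c \<Longrightarrow> bump c d x = x"
    "c \<le> x \<Longrightarrow> x \<le> c + d \<Longrightarrow> bump c d x = 2 * x - c"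
    "c + d \<le> x \<Longrightarrow> x \<le> c + 2 * d \<Longrightarrow> bump c d x = x + d"
    "c + 2 * d \<le> x \<Longrightarrow> x \<le> c + 4 * d \<Longrightarrow> bump c d x = (x + c + 4 * d) / 2"
    "c + 4 * d \<le> x \<Longrightarrow> bump c d x = x"
  using assms by (simp_all add: bump_def min_def max_def field_simps)

lemma bump_inv_eqs:
  assumes "0 < d"
  shows "x \<le> c \<Longrightarrow> bump_inv c d x = x"
    "c \<le> x \<Longrightarrow> x \<le> c + 2 * d \<Longrightarrow> bump_inv c d x = (x + c) / 2"
    "c + 2 * d \<le> x \<Longrightarrow> x \<le> c + 3 * d \<Longrightarrow> bump_inv c d x = x - d"
    "c + 3 * d \<le> x \<Longrightarrow> x \<le> c + 4 * d \<Longrightarrow> bump_inv c d x = 2 * x - c - 4 * d"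
    "c + 4 * d \<le> x \<Longrightarrow> bump_inv c d x = x"
  using assms by (simp_all add: bump_inv_def min_def max_def field_simps)

lemma bump_cases:
  fixes c d x :: real
  obtains "x \<le> c" | "c \<le> x" "x \<le> c + d" | "c + d \<le> x" "x \<le> c + 2 * d"
    | "c + 2 * d \<le> x" "x \<le> c + 3 * d"| "c + 3 * d \<le> x" "x \<le> c + 4 * d" | "c + 4 * d \<le> x"
  by linarith

lemma bump_inverse:
  assumes "0 < d"
  shows "bump_inv c d (bump c d x) = x" "bump c d (bump_inv c d x) = x"
  by (rule bump_cases[where x = x and c = c and d = d];
      use assms in \<open>simp add: bump_eqs bump_inv_eqs field_simps\<close>)+

lemma bump_gt: "0 < d \<Longrightarrow> c < x \<Longrightarrow> x < c + 4 * d \<Longrightarrow> x < bump c d x"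
  by (simp add: bump_def less_max_iff_disj)

lemma bump_unit: 
  assumes "0 < d" "0 \<le> c" "c + 4 * d \<le> 1" "x \<in> {0..1}"
  shows "bump c d x \<in> {0..1}" "bump_inv c d x \<in> {0..1}"
  by (rule bump_cases[where x = x and c = c and d = d];
      use assms in \<open>simp add: bump_eqs bump_inv_eqs field_simps\<close>)+

lemma bump_in_thompson_F:
  assumes i: "i + 4 \<le> 2 ^ n"
  shows "restrict (bump (real i / 2 ^ n) (1 / 2 ^ n)) {0..1} \<in> carrier thompson_F"
proof -
  define c d :: real where "c = real i / 2 ^ n" and "d = 1 / 2 ^ n"
  have "real (i + 4) \<le> real (2 ^ n)" using i by (simp only: of_nat_le_iff)
  then have cd: "0 < d" "0 \<le> c" "c + 4 * d \<le> 1" by (auto simp: c_def d_def field_simps)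
  let ?f = "restrict (bump c d) {0..1}"
  have "bij_betw ?f {0..1} {0..1}"
    by (rule bij_betw_byWitness[where f' = "bump_inv c d"])
       (use bump_inverse[OF cd(1)] bump_unit[OF cd] in auto)
  then have Bij: "?f \<in> Bij {0..1}" by (simp add: Bij_def)
  have "continuous_on {0..1} (bump c d)" "continuous_on {0..1} (bump_inv c d)"
    unfolding bump_def bump_inv_def by (intro continuous_intros; simp)+
  then have "homeomorphism {0..1} {0..1} (bump c d) (bump_inv c d)"
    using bump_inverse[OF cd(1)] bump_unit[OF cd] by (intro homeomorphismI) auto
  then have homeo: "homeomorphism {0..1} {0..1} ?f (bump_inv c d)"
    by (rule homeomorphism_cong) auto
  let ?P = "{c, c + d, c + 2 * d, c + 4 * d}"
  have pl: "piecewise_linear_on_unit ?f"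
    unfolding piecewise_linear_on_unit_def
  proof (intro exI[of _ ?P] conjI allI impI)
    fix a b assume ab: "0 \<le> a" "a < b" "b \<le> 1" "{a<..<b} \<inter> ?P = {}"
    have out: "p \<le> a \<or> b \<le> p" if "p \<in> ?P" for p using ab(4) that by force
    have lin: "\<exists>s t. \<forall>x\<in>{a..b}. ?f x = s * x + t" if "\<And>x. a \<le> x \<Longrightarrow> x \<le> b \<Longrightarrow> bump c d x = s * x + t" for s t
      using that ab by (intro exI[of _ s] exI[of _ t]) auto
    consider "b \<le> c" | "c \<le> a" "b \<le> c + d" | "c + d \<le> a" "b \<le> c + 2 * d"
      | "c + 2 * d \<le> a" "b \<le> c + 4 * d" | "c + 4 * d \<le> a"
      using out[of c] out[of "c + d"] out[of "c + 2 * d"] out[of "c + 4 * d"] by blast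
    then show "\<exists>s t. \<forall>x\<in>{a..b}. ?f x = s * x + t"
    proof cases
      case 1 show ?thesis by (rule lin[of 1 0]) (use 1 bump_eqs(1)[OF cd(1)] in auto)
    next
      case 2 show ?thesis by (rule lin[of 2 "- c"]) (use 2 bump_eqs(2)[OF cd(1)] in auto)
    next
      case 3 show ?thesis by (rule lin[of 1 d]) (use 3 bump_eqs(3)[OF cd(1)] in auto)
    next
      case 4 show ?thesis by (rule lin[of "1/2" "(c + 4 * d) / 2"]) (use 4 bump_eqs(4)[OF cd(1)] in \<open>auto simp: field_simps\<close>)
    next
      case 5 show ?thesis by (rule lin[of 1 0]) (use 5 bump_eqs(5)[OF cd(1)] in auto)
    qed
  qed simp
  have "\<exists>m::int. (?f has_real_derivative 2 powi m) (at x within {0..1})" if x: "x \<in> {0..1} - ?P" for x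
  proof -
    have lin: "(?f has_real_derivative s) (at x within {0..1})"
      if "open S" "x \<in> S" "\<And>y. y \<in> S \<Longrightarrow> bump c d y = s * y + t" for S s t
    proof -
      have "((\<lambda>y. s * y + t) has_real_derivative s) (at x)" by (auto intro!: derivative_eq_intros)
      then have "(bump c d has_real_derivative s) (at x)"
        by (rule has_field_derivative_transform_within_open[OF _ that(1,2)]) (simp add: that(3))
      then have "(bump c d has_real_derivative s) (at x within {0..1})" by (rule has_field_derivative_at_within)
      then show ?thesis by (rule has_field_derivative_transform_within[where d = 1]) (use x in auto)
    qed
    consider "x < c" | "c < x" "x < c + d" | "c + d < x" "x < c + 2 * d"
      | "c + 2 * d < x" "x < c + 4 * d" | "c + 4 * d < x"
      using x by force
    then show ?thesis
    proof cases
      case 1 show ?thesis by (rule exI[of _ 0], simp, rule lin[of "{..<c}" 1 0]) (use 1 bump_eqs(1)[OF cd(1)] in auto)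
    next
      case 2 show ?thesis by (rule exI[of _ 1], simp, rule lin[of "{c<..<c+d}" 2 "- c"]) (use 2 bump_eqs(2)[OF cd(1)] in auto)
    next
      case 3 show ?thesis by (rule exI[of _ 0], simp, rule lin[of "{c+d<..<c+2*d}" 1 d]) (use 3 bump_eqs(3)[OF cd(1)] in auto)
    next
      case 4
      have "(?f has_real_derivative 1/2) (at x within {0..1})"
        by (rule lin[of "{c+2*d<..<c+4*d}" "1/2" "(c + 4 * d) / 2"]) (use 4 bump_eqs(4)[OF cd(1)] in \<open>auto simp: field_simps\<close>)
      then show ?thesis by (intro exI[of _ "-1"]) simp
    next
      case 5 show ?thesis by (rule exI[of _ 0], simp, rule lin[of "{c+4*d<..}" 1 0]) (use 5 bump_eqs(5)[OF cd(1)] in auto)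
    qed
  qed
  moreover have "?P \<subseteq> dyadic_rationals"
  proof -
    have "real j / 2 ^ n \<in> dyadic_rationals" for j
      unfolding dyadic_rationals_def by (intro CollectI exI[of _ "int j"] exI[of _ n]) simp
    from this[of i] this[of "i + 1"] this[of "i + 2"] this[of "i + 4"] show ?thesis
      by (simp add: c_def d_def add_divide_distrib add.commute)
  qed
  ultimately have "\<exists>D. finite D \<and> D \<subseteq> dyadic_rationals \<and>
      (\<forall>x\<in>{0..1} - D. \<exists>m::int. (?f has_real_derivative 2 powi m) (at x within {0..1}))"
    by (intro exI[of _ ?P]) auto
  then show ?thesis using Bij homeo pl unfolding thompson_F_def c_def d_def by auto
qed


section \<open>Normal subgroups of Thompson's group\<close>

lemma thompson_F_mult:
  assumes "f \<in> carrier thompson_F" "g \<in> carrier thompson_F" "x \<in> {0..1}"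
  shows "(f \<otimes>\<^bsub>thompson_F\<^esub> g) x = f (g x)"
  using thompson_F_Bij[OF assms(1)] thompson_F_Bij[OF assms(2)] assms(3)
  by (simp add: thompson_F_def BijGroup_def compose_eq)

lemma thompson_F_one: "x \<in> {0..1} \<Longrightarrow> \<one>\<^bsub>thompson_F\<^esub> x = x"
  by (simp add: thompson_F_def BijGroup_def)

lemma thompson_F_ext:
  assumes "f \<in> carrier thompson_F" "g \<in> carrier thompson_F" "\<And>x. x \<in> {0..1} \<Longrightarrow> f x = g x"
  shows "f = g"
  using thompson_F_Bij[OF assms(1)] thompson_F_Bij[OF assms(2)] assms(3)
  by (intro extensionalityI[of f "{0..1}" g]) (simp_all add: Bij_def)

lemma thompson_F_moves:
  assumes f: "f \<in> carrier thompson_F" and ne: "f \<noteq> \<one>\<^bsub>thompson_F\<^esub>" and grp: "group thompson_F"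
  obtains x where "x \<in> {0..1}" "f x \<noteq> x"
proof -
  interpret group thompson_F by (rule grp)
  have "\<exists>x\<in>{0..1}. f x \<noteq> x"
  proof (rule ccontr)
    assume "\<not> ?thesis"
    then have "f x = \<one>\<^bsub>thompson_F\<^esub> x" if "x \<in> {0..1}" for x using that thompson_F_one by simp
    then have "f = \<one>\<^bsub>thompson_F\<^esub>" using f by (intro thompson_F_ext) simp_all
    then show False using ne by simp
  qed
  then show thesis using that by blast
qed

lemma thompson_F_unit: "f \<in> carrier thompson_F \<Longrightarrow> x \<in> {0..1} \<Longrightarrow> f x \<in> {0..1}"
  using thompson_F_image by blast

lemma thompson_F_interior:
  assumes "f \<in> carrier thompson_F" "0 < x" "x < 1"
  shows "0 < f x" "f x < 1"
  using thompson_F_less[OF assms(1), of 0 x] thompson_F_less[OF assms(1), of x 1]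
    thompson_F_endpoints[OF assms(1)] assms by simp_all

text \<open>
  Elements with disjoint supports commute, since each of them maps its support to itself.
\<close>

lemma thompson_F_commute:
  assumes f: "f \<in> carrier thompson_F" and g: "g \<in> carrier thompson_F" and grp: "group thompson_F"
    and disj: "\<And>x. x \<in> {0..1} \<Longrightarrow> f x = x \<or> g x = x"
  shows "f \<otimes>\<^bsub>thompson_F\<^esub> g = g \<otimes>\<^bsub>thompson_F\<^esub> f"
proof -
  interpret group thompson_F by (rule grp)
  have inj: "h x = h y \<Longrightarrow> x = y" if "h \<in> carrier thompson_F" "x \<in> {0..1}" "y \<in> {0..1}" for h x y
    using thompson_F_Bij[OF that(1)] that(2,3) by (auto simp: Bij_def bij_betw_def dest: inj_onD)
  have "f (g x) = g (f x)" if x: "x \<in> {0..1}" for x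
  proof (cases "f x = x")
    case True
    show ?thesis
    proof (cases "g x = x")
      case False
      then have "g (g x) \<noteq> g x" using inj[OF g] thompson_F_unit[OF g] x by blast
      then have "f (g x) = g x" using disj thompson_F_unit[OF g x] by blast
      then show ?thesis using True by simp
    qed (use True in simp)
  next
    case False
    then have "f (f x) \<noteq> f x" using inj[OF f] thompson_F_unit[OF f] x by blast
    then have "g (f x) = f x" using disj thompson_F_unit[OF f x] by blast
    moreover have "g x = x" using disj[OF x] False by blast
    ultimately show ?thesis by simp
  qed
  then show ?thesis using f g by (intro thompson_F_ext) (auto simp: thompson_F_mult)
qed

text \<open>
  Under an increasing map the orbit of a point that is moved is strictly monotone.
\<close>

lemma thompson_F_inj_pow:
  assumes g: "g \<in> carrier thompson_F" and ne: "g \<noteq> \<one>\<^bsub>thompson_F\<^esub>" and grp: "group thompson_F"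
  shows "inj (\<lambda>n::nat. g [^]\<^bsub>thompson_F\<^esub> n)"
proof -
  interpret group thompson_F by (rule grp)
  obtain x where x: "x \<in> {0..1}" "g x \<noteq> x" using thompson_F_moves[OF g ne grp] .
  let ?p = "\<lambda>n::nat. g [^]\<^bsub>thompson_F\<^esub> n"
  have Suc: "?p (Suc n) x = ?p n (g x)" for n
    using thompson_F_mult[OF nat_pow_closed[OF g] g x(1)] by simp
  have gx: "g x \<in> {0..1}" by (rule thompson_F_unit[OF g x(1)])
  have pc: "?p n \<in> carrier thompson_F" for n using g by simp
  have "inj (\<lambda>n. ?p n x)"
  proof (cases "x < g x")
    case True
    have "strict_mono (\<lambda>n. ?p n x)"
      unfolding strict_mono_Suc_iff Suc
      using thompson_F_less[OF pc, of x "g x"] True x(1) gx by simp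
    then show ?thesis by (rule strict_mono_imp_inj_on)
  next
    case False
    have "strict_mono (\<lambda>n. - ?p n x)"
      unfolding strict_mono_Suc_iff Suc
      using thompson_F_less[OF pc, of "g x" x] False x gx by simp
    then have "inj (\<lambda>n. - ?p n x)" by (rule strict_mono_imp_inj_on)
    then show ?thesis by (simp add: inj_def)
  qed
  then show ?thesis by (auto simp: inj_def)
qed

lemma thompson_F_inv:
  assumes f: "f \<in> carrier thompson_F" and grp: "group thompson_F" and x: "x \<in> {0..1}"
  shows "f ((inv\<^bsub>thompson_F\<^esub> f) x) = x" "(inv\<^bsub>thompson_F\<^esub> f) (f x) = x"
proof -
  interpret group thompson_F by (rule grp)
  show "f ((inv\<^bsub>thompson_F\<^esub> f) x) = x"
    using thompson_F_mult[OF f inv_closed[OF f] x] thompson_F_one[OF x] f by simp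
  show "(inv\<^bsub>thompson_F\<^esub> f) (f x) = x"
    using thompson_F_mult[OF inv_closed[OF f] f x] thompson_F_one[OF x] f by simp
qed

text \<open>
  The bump with full support moves every point between \<open>u\<close> and \<open>r\<close> to the right by at least some
  fixed \<open>m > 0\<close>, so its iterates push \<open>u\<close> beyond \<open>r\<close>.
\<close>

lemma thompson_F_push:
  assumes "group thompson_F" and u: "0 < u" "u < 1" and r: "r < 1"
  shows "\<exists>k\<in>carrier thompson_F. r < k u"
proof -
  interpret group thompson_F by (rule assms)
  define y where "y = restrict (bump 0 (1/4)) {0..1 :: real}"
  have y: "y \<in> carrier thompson_F" using bump_in_thompson_F[of 0 2] by (simp add: y_def)
  define m where "m = min u (min (1/4) ((1 - r) / 2))"
  have m: "0 < m" "m \<le> u" "m \<le> 1/4" "m \<le> (1 - r) / 2" using u r by (auto simp: m_def min_def)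
  have y_ge: "x + m \<le> y x" if "u \<le> x" "x \<le> r" for x
  proof -
    have "x + m \<le> bump 0 (1/4) x" using that u r m by (simp add: bump_def le_max_iff_disj)
    then show ?thesis using that u r by (simp add: y_def)
  qed
  have "\<exists>k\<in>carrier thompson_F. r < k u \<or> (u + real n * m \<le> k u)" for n
  proof (induction n)
    case 0
    show ?case using u thompson_F_one[of u] by (intro bexI[of _ "\<one>\<^bsub>thompson_F\<^esub>"]) auto
  next
    case (Suc n)
    then obtain k where k: "k \<in> carrier thompson_F" "r < k u \<or> u + real n * m \<le> k u" by blast
    show ?case
    proof (cases "r < k u")
      case False
      have "(y \<otimes>\<^bsub>thompson_F\<^esub> k) u = y (k u)" using thompson_F_mult[OF y k(1)] u by simp
      moreover have "0 \<le> real n * m" using m by simp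
      then have "u \<le> k u" using k(2) False by linarith
      ultimately have "k u + m \<le> (y \<otimes>\<^bsub>thompson_F\<^esub> k) u" using y_ge False by simp
      then have "u + real (Suc n) * m \<le> (y \<otimes>\<^bsub>thompson_F\<^esub> k) u" using k(2) False by (simp add: algebra_simps)
      then show ?thesis using y k(1) by (intro bexI[of _ "y \<otimes>\<^bsub>thompson_F\<^esub> k"]) auto
    qed (use k in blast)
  qed
  moreover obtain n where "1 / m < real n" using reals_Archimedean2 by blast
  then have "1 < real n * m" using m by (simp add: field_simps)
  ultimately obtain k where k: "k \<in> carrier thompson_F" "r < k u \<or> u + real n * m \<le> k u" by blast
  have "k u < 1" using thompson_F_interior[OF k(1)] u by simp
  then have "r < k u" using k(2) u \<open>1 < real n * m\<close> by linarith
  then show ?thesis using k(1) by blast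
qed

text \<open>
  Let \<open>f\<close> in \<open>N\<close> move a point \<open>x\<close>. Choose a dyadic interval \<open>J\<close> strictly between \<open>x\<close> and \<open>f x\<close>. Then
  \<open>f\<close> moves \<open>J\<close> off itself, by monotonicity. For an element \<open>b\<close> of \<open>F\<close> supported in \<open>J\<close> the commutator
  \<open>b f b\<^sup>-\<^sup>1 f\<^sup>-\<^sup>1\<close> lies in \<open>N\<close>, agrees with \<open>b\<close> on \<open>J\<close>, and is the identity outside \<open>J\<close> and \<open>f J\<close>,
  two intervals that stay away from 0 and 1.
\<close>

lemma normal_subgroup_compact_support:
  assumes N: "N \<lhd> thompson_F" and ne: "N \<noteq> {\<one>\<^bsub>thompson_F\<^esub>}"
  obtains a l r where "a \<in> N" "a \<noteq> \<one>\<^bsub>thompson_F\<^esub>" "0 < l" "l < 1" "r < 1"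
    "\<And>x. x \<in> {0..1} \<Longrightarrow> x \<le> l \<or> r \<le> x \<Longrightarrow> a x = x"
proof -
  interpret normal N thompson_F by (rule N)
  let ?m = "mult thompson_F" and ?i = "m_inv thompson_F"
  have "\<one>\<^bsub>thompson_F\<^esub> \<in> N" using subgroup_axioms by (rule subgroup.one_closed)
  then have "\<not> N \<subseteq> {\<one>\<^bsub>thompson_F\<^esub>}" using ne by blast
  then obtain f where f: "f \<in> N" "f \<noteq> \<one>\<^bsub>thompson_F\<^esub>" by auto
  have fc: "f \<in> carrier thompson_F" using f subset by blast
  note grp = is_group
  obtain x where x: "x \<in> {0..1}" "f x \<noteq> x" using thompson_F_moves[OF fc f(2) grp] .
  have x': "0 < x" "x < 1" using x thompson_F_endpoints[OF fc] by (auto simp: less_le)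
  have fx: "0 < f x" "f x < 1" using thompson_F_interior[OF fc x'] .
  define u v where "u = min x (f x)" and "v = max x (f x)"
  have uv: "0 < u" "u < v" "v < 1" using x(2) x' fx by (auto simp: u_def v_def)
  obtain i n where i: "u < real i / 2 ^ n" "real (i + 4) / 2 ^ n < v" "i + 4 \<le> 2 ^ n"
    using dyadic_between[of u v] uv by auto
  define c d :: real where "c = real i / 2 ^ n" and "d = 1 / 2 ^ n"
  have d0: "0 < d" by (simp add: d_def)
  have cd: "u < c" "c + 4 * d < v" using i by (auto simp: c_def d_def add_divide_distrib)
  define b where "b = restrict (bump c d) {0..1}"
  have b: "b \<in> carrier thompson_F" using bump_in_thompson_F[OF i(3)] by (simp add: b_def c_def d_def)
  have b_out: "b y = y" if "y \<in> {0..1}" "y \<le> c \<or> c + 4 * d \<le> y" for y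
    using that bump_eqs(1,5)[OF d0] by (auto simp: b_def)
  have fJ: "f y < c \<or> c + 4 * d < f y" if "c \<le> y" "y \<le> c + 4 * d" for y
  proof (cases "x < f x")
    case True
    then have "f x < f y" using thompson_F_less[OF fc, of x y] that cd x' uv by (auto simp: u_def v_def)
    then show ?thesis using cd True by (auto simp: v_def)
  next
    case False
    then have "f y < f x" using thompson_F_less[OF fc, of y x] that cd x' uv by (auto simp: u_def v_def)
    then show ?thesis using cd False by (auto simp: u_def)
  qed
  have ib: "?i b \<in> carrier thompson_F" and iF: "?i f \<in> carrier thompson_F" using b fc by simp_all
  have ib_out: "(?i b) y = y" if "y \<in> {0..1}" "y \<le> c \<or> c + 4 * d \<le> y" for y
    using thompson_F_inv(2)[OF b grp that(1)] b_out[OF that] by simp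
  define a where "a = ?m (?m (?m b f) (?i b)) (?i f)"
  have ac: "a \<in> carrier thompson_F" unfolding a_def using b fc by simp
  have a_eval: "a y = b (f ((?i b) ((?i f) y)))" if y: "y \<in> {0..1}" for y
    unfolding a_def using b fc ib iF y thompson_F_unit[OF iF y] thompson_F_unit[OF ib thompson_F_unit[OF iF y]]
    by (simp add: thompson_F_mult)
  have a_simp: "a y = b y" if y: "y \<in> {0..1}" and out: "(?i f) y \<le> c \<or> c + 4 * d \<le> (?i f) y" for y
    using a_eval[OF y] ib_out[OF thompson_F_unit[OF iF y] out] thompson_F_inv(1)[OF fc grp y] by simp
  define l where "l = min c (f c)"
  define r where "r = max (c + 4 * d) (f (c + 4 * d))"
  show thesis
  proof
    have "?m (?m b f) (?i b) \<in> N" using inv_op_closed2[OF b f(1)] .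
    then show "a \<in> N" unfolding a_def using f(1) by simp
    show "0 < l" "l < 1" using thompson_F_interior[OF fc, of c] cd uv d0 by (auto simp: l_def)
    show "r < 1" using thompson_F_interior[OF fc, of "c + 4 * d"] cd uv d0 by (auto simp: r_def)
    show "a \<noteq> \<one>\<^bsub>thompson_F\<^esub>"
    proof
      assume a1: "a = \<one>\<^bsub>thompson_F\<^esub>"
      let ?y = "c + d"
      have y: "?y \<in> {0..1}" using cd uv d0 by auto
      have out: "(?i f) ?y \<le> c \<or> c + 4 * d \<le> (?i f) ?y"
      proof (rule ccontr)
        assume "\<not> ?thesis"
        then have "f ((?i f) ?y) < c \<or> c + 4 * d < f ((?i f) ?y)" by (intro fJ) auto
        then show False using thompson_F_inv(1)[OF fc grp y] d0 by auto
      qed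
      have "a ?y = b ?y" using a_simp[OF y out] .
      moreover have "b ?y > ?y" using bump_gt[OF d0, of c ?y] d0 y by (simp add: b_def)
      ultimately show False using a1 thompson_F_one[OF y] by simp
    qed
    fix y :: real assume y: "y \<in> {0..1}" and lr: "y \<le> l \<or> r \<le> y"
    let ?z = "(?i f) y"
    have z: "?z \<in> {0..1}" "f ?z = y" using thompson_F_unit[OF iF y] thompson_F_inv(1)[OF fc grp y] by auto
    have "?z \<le> c \<or> c + 4 * d \<le> ?z"
    proof (rule ccontr)
      assume "\<not> ?thesis"
      then have "f c < y" "y < f (c + 4 * d)"
        using thompson_F_less[OF fc, of c ?z] thompson_F_less[OF fc, of ?z "c + 4 * d"] z cd uv by auto
      then show False using lr by (auto simp: l_def r_def)
    qed
    then have "a y = b y" by (rule a_simp[OF y])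
    also have "\<dots> = y" using b_out[OF y] lr by (auto simp: l_def r_def)
    finally show "a y = y" .
  qed
qed

text \<open>
  The conjugate \<open>c = k\<^sup>-\<^sup>1 a k\<close> is supported to the left of \<open>u\<close> as soon as \<open>k\<close> pushes \<open>u\<close> beyond the
  support of \<open>a\<close>. With \<open>u\<close> at most \<open>l\<close> and \<open>h\<^sup>-\<^sup>1 l\<close>, both \<open>c\<close> and \<open>h c h\<^sup>-\<^sup>1\<close> are supported to the
  left of \<open>l\<close>, where \<open>a\<close> is the identity.
\<close>

lemma normal_subgroup_linked:
  assumes N: "N \<lhd> thompson_F" and ne: "N \<noteq> {\<one>\<^bsub>thompson_F\<^esub>}"
  obtains a where "a \<in> N" "a \<noteq> \<one>\<^bsub>thompson_F\<^esub>"
    "\<forall>h\<in>N. \<exists>b\<in>N. b \<noteq> \<one>\<^bsub>thompson_F\<^esub> \<and>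
       a \<otimes>\<^bsub>thompson_F\<^esub> b = b \<otimes>\<^bsub>thompson_F\<^esub> a \<and>
       (\<exists>c\<in>N. c \<noteq> \<one>\<^bsub>thompson_F\<^esub> \<and> a \<otimes>\<^bsub>thompson_F\<^esub> c = c \<otimes>\<^bsub>thompson_F\<^esub> a \<and>
          h \<otimes>\<^bsub>thompson_F\<^esub> c = b \<otimes>\<^bsub>thompson_F\<^esub> h)"
proof -
  interpret normal N thompson_F by (rule N)
  let ?m = "mult thompson_F" and ?i = "m_inv thompson_F"
  note grp = is_group
  obtain a l r where a: "a \<in> N" "a \<noteq> \<one>\<^bsub>thompson_F\<^esub>" and lr: "0 < l" "l < 1" "r < 1"
    and fix_a: "\<And>x. x \<in> {0..1} \<Longrightarrow> x \<le> l \<or> r \<le> x \<Longrightarrow> a x = x"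
    using normal_subgroup_compact_support[OF N ne] by metis
  have ac: "a \<in> carrier thompson_F" using a subset by blast
  show thesis
  proof (rule that[OF a], rule ballI)
    fix h assume hN: "h \<in> N"
    then have h: "h \<in> carrier thompson_F" using subset by blast
    then have ih: "?i h \<in> carrier thompson_F" by simp
    define u where "u = min l ((?i h) l)"
    have u: "0 < u" "u < 1" using lr thompson_F_interior[OF ih, of l] by (auto simp: u_def)
    obtain k where k: "k \<in> carrier thompson_F" "r < k u" using thompson_F_push[OF grp u lr(3)] by blast
    have ik: "?i k \<in> carrier thompson_F" using k by simp
    define c where "c = ?m (?m (?i k) a) k"
    define b where "b = ?m (?m h c) (?i h)"
    have cN: "c \<in> N" unfolding c_def by (rule inv_op_closed1[OF k(1) a(1)])
    then have cc: "c \<in> carrier thompson_F" using subset by blast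
    have bN: "b \<in> N" unfolding b_def by (rule inv_op_closed2[OF h cN])
    then have bc: "b \<in> carrier thompson_F" using subset by blast
    have hc: "?m h c = ?m b h" unfolding b_def using h cc by (simp add: m_assoc)
    have c1: "c \<noteq> \<one>\<^bsub>thompson_F\<^esub>"
    proof
      assume "c = \<one>\<^bsub>thompson_F\<^esub>"
      then have "?m (?m k c) (?i k) = \<one>\<^bsub>thompson_F\<^esub>" using k by simp
      moreover have "?m (?m k c) (?i k) = a" unfolding c_def using k ac
        by (simp add: m_assoc) (simp add: m_assoc[symmetric])
      ultimately show False using a(2) by simp
    qed
    have b1: "b \<noteq> \<one>\<^bsub>thompson_F\<^esub>"
    proof
      assume "b = \<one>\<^bsub>thompson_F\<^esub>"
      then have "?m h c = ?m h \<one>\<^bsub>thompson_F\<^esub>" using hc h by simp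
      then show False using c1 h cc by simp
    qed
    have fix_c: "c x = x" if x: "x \<in> {0..1}" "u \<le> x" for x
    proof -
      have kx: "k x \<in> {0..1}" by (rule thompson_F_unit[OF k(1) x(1)])
      have "k u \<le> k x" using thompson_F_le[OF k(1), of u x] x u by simp
      then have "a (k x) = k x" using fix_a[OF kx] k(2) by simp
      moreover have "c x = (?i k) (a (k x))"
        unfolding c_def using k ik ac x kx by (simp add: thompson_F_mult)
      ultimately show ?thesis using thompson_F_inv(2)[OF k(1) grp x(1)] by simp
    qed
    have fix_b: "b x = x" if x: "x \<in> {0..1}" "l \<le> x" for x
    proof -
      have y: "(?i h) x \<in> {0..1}" by (rule thompson_F_unit[OF ih x(1)])
      have "u \<le> (?i h) x" using thompson_F_le[OF ih, of l x] x lr by (auto simp: u_def)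
      then have "c ((?i h) x) = (?i h) x" by (rule fix_c[OF y])
      moreover have "b x = h (c ((?i h) x))"
        unfolding b_def using h cc ih x y by (simp add: thompson_F_mult)
      ultimately show ?thesis using thompson_F_inv(1)[OF h grp x(1)] by simp
    qed
    have "?m a b = ?m b a"
      by (rule thompson_F_commute[OF ac bc grp]) (use fix_a fix_b linear in blast)
    moreover have "?m a c = ?m c a"
    proof (rule thompson_F_commute[OF ac cc grp])
      fix x :: real assume "x \<in> {0..1}"
      moreover have "u \<le> x \<or> x \<le> l" by (auto simp: u_def)
      ultimately show "a x = x \<or> c x = x" using fix_a fix_c by blast
    qed
    ultimately show "\<exists>b\<in>N. b \<noteq> \<one>\<^bsub>thompson_F\<^esub> \<and> ?m a b = ?m b a \<and>
       (\<exists>c\<in>N. c \<noteq> \<one>\<^bsub>thompson_F\<^esub> \<and> ?m a c = ?m c a \<and> ?m h c = ?m b h)"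
      using bN b1 cN c1 hc by blast
  qed
qed

section \<open>The cost of a normal subgroup\<close>

theorem theorem4p4:
  fixes M :: "'a measure" and N :: "(real \<Rightarrow> real) set"
  assumes "prob_space M" and "standard_borel M"
    and atomless: "\<forall>x\<in>space M. emeasure M {x} = 0"
    and "N \<lhd> thompson_F" and "N \<noteq> {\<one>\<^bsub>thompson_F\<^esub>}"
  shows "group_cost M (thompson_F\<lparr>carrier := N\<rparr>) = 1"
proof -
  interpret F: normal N thompson_F by (rule assms(4))
  let ?G = "thompson_F\<lparr>carrier := N\<rparr>"
  have G: "group ?G" by (rule F.subgroup_is_group[OF F.is_group])
  have countable: "countable (carrier ?G)"
    using countable_subset[OF F.subset countable_thompson_F] by simp
  have inj_pow: "inj (\<lambda>n::nat. g [^]\<^bsub>?G\<^esub> n)" if "g \<in> N" "g \<noteq> \<one>\<^bsub>thompson_F\<^esub>" for g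
    using thompson_F_inj_pow[of g] that F.subset F.is_group
    by (simp add: nat_pow_def subset_iff)
  obtain a where a: "a \<in> N" "a \<noteq> \<one>\<^bsub>thompson_F\<^esub>"
    and link: "\<forall>h\<in>N. \<exists>b\<in>N. b \<noteq> \<one>\<^bsub>thompson_F\<^esub> \<and>
       a \<otimes>\<^bsub>thompson_F\<^esub> b = b \<otimes>\<^bsub>thompson_F\<^esub> a \<and>
       (\<exists>c\<in>N. c \<noteq> \<one>\<^bsub>thompson_F\<^esub> \<and> a \<otimes>\<^bsub>thompson_F\<^esub> c = c \<otimes>\<^bsub>thompson_F\<^esub> a \<and>
          h \<otimes>\<^bsub>thompson_F\<^esub> c = b \<otimes>\<^bsub>thompson_F\<^esub> h)"
    using normal_subgroup_linked[OF assms(4,5)] .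
  have infinite: "infinite (carrier ?G)"
  proof -
    have "a [^]\<^bsub>?G\<^esub> n \<in> carrier ?G" for n :: nat
      using monoid.nat_pow_closed[OF group.is_monoid[OF G]] a(1) by simp
    then have "range (\<lambda>n::nat. a [^]\<^bsub>?G\<^esub> n) \<subseteq> carrier ?G" by blast
    moreover have "infinite (range (\<lambda>n::nat. a [^]\<^bsub>?G\<^esub> n))"
      using range_inj_infinite[OF inj_pow[OF a]] .
    ultimately show ?thesis using finite_subset by blast
  qed
  have ge: "1 \<le> group_cost M ?G"
    unfolding group_cost_def
  proof (rule Inf_greatest, safe)
    fix \<alpha> assume "mp_action M ?G \<alpha>" "essentially_free M ?G \<alpha>"
    then interpret free_pmp_action M ?G \<alpha>
      using assms countable by (simp add: free_pmp_action_def free_pmp_action_axioms_def)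
    show "1 \<le> relation_cost M (orbit_relation M ?G \<alpha>)" by (rule relation_cost_ge_one[OF infinite])
  qed
  obtain \<alpha> where "free_pmp_action M ?G \<alpha>"
    using exists_free_pmp_action[OF G countable infinite assms(1,2) atomless] by blast
  then interpret free_pmp_action M ?G \<alpha> .
  have "group_cost M ?G \<le> relation_cost M (orbit_relation M ?G \<alpha>)"
    unfolding group_cost_def using action free by (intro Inf_lower) blast
  also have "\<dots> \<le> 1"
  proof (rule relation_cost_le_one)
    show "a \<in> carrier ?G" using a by simp
    show "inj (\<lambda>n::nat. a [^]\<^bsub>?G\<^esub> n)" by (rule inj_pow[OF a])
    fix h assume "h \<in> carrier ?G"
    then have "h \<in> N" by simp
    from link[rule_format, OF this] show "\<exists>b\<in>carrier ?G. inj (\<lambda>n::nat. b [^]\<^bsub>?G\<^esub> n) \<and> a \<otimes>\<^bsub>?G\<^esub> b = b \<otimes>\<^bsub>?G\<^esub> a \<and>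
       (\<exists>c\<in>carrier ?G. inj (\<lambda>n::nat. c [^]\<^bsub>?G\<^esub> n) \<and> a \<otimes>\<^bsub>?G\<^esub> c = c \<otimes>\<^bsub>?G\<^esub> a \<and> h \<otimes>\<^bsub>?G\<^esub> c = b \<otimes>\<^bsub>?G\<^esub> h)"
      using inj_pow by simp blast
  qed
  finally show ?thesis using ge by (rule antisym)
qed

end
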